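(* For every integer $m \ge 0$ and every $f \in L^2(B^2)$, the partial sum $S_{2m} f$ of the orthogonal expansion of $f$ can be written as $$S_{2m}(f;x,y) = \sum_{\nu=0}^{2m} \frac{1}{\pi} \int_{-1}^1 \mathcal{R}_{\phi_\nu}(f;t)\, \Phi_\nu(t;x,y)\, dt,$$ where $$\Phi_\nu(t;x,y) = \frac{1}{2m+1} \sum_{k=0}^{2m} (k+1)\, U_k(t)\, U_k(\phi_\nu;x,y), \qquad \phi_\nu = \frac{2\pi\nu}{2m+1}.$$
   Context: $B^2=\{(x,y)\in\mathbb{R}^2: x^2+y^2\le 1\}$. The Radon projection of a function $f$ on $B^2$ in direction $\theta$ with parameter $t\in[-1,1]$ is $$\mathcal{R}_\theta(f;t)=\int_{-\sqrt{1-t^2}}^{\sqrt{1-t^2}} f(t\cos\theta - s\sin\theta,\ t\sin\theta+s\cos\theta)\,ds$$ (the line integral of $f$ over $\{x\cos\theta+y\sin\theta=t\}\cap B^2$; for integrable $f$ it is defined for almost every $t$). $U_k$ is the Chebyshev polynomial of the second kind, $U_k(\cos\theta)=\sin((k+1)\theta)/\sin\theta$, and $U_k(\theta;x,y):=U_k(x\cos\theta+y\sin\theta)$. $\Pi_n^2$ is the space of real polynomials in two variables of total degree at most $n$. $\mathcal{V}_k(B^2)$ is the space of polynomials $P$ of degree $k$ (together with $0$) with $\int_{B^2}P\,Q\,dx\,dy=0$ for all $Q\in\Pi_{k-1}^2$. $\operatorname{proj}_k f$ denotes the orthogonal projection of $f\in L^2(B^2)$ (Lebesgue measure) onto $\mathcal{V}_k(B^2)$,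 and $S_n f=\sum_{k=0}^n \operatorname{proj}_k f$. *)

theory Defs
  imports "HOL-Analysis.Analysis" "HOL-Computational_Algebra.Polynomial"
begin

definition disc :: "(real \<times> real) set" where
  "disc = {(x, y). x\<^sup>2 + y\<^sup>2 \<le> 1}"

text \<open>Members of \<open>L2_disc\<close> are functions rather than classes of functions modulo null sets;
  their values outside the disc are irrelevant.\<close>

definition L2_disc :: "(real \<times> real \<Rightarrow> real) set" where
  "L2_disc = {f. set_borel_measurable lebesgue disc f \<and>
                 set_integrable lebesgue disc (\<lambda>p. (f p)\<^sup>2)}"

definition radon :: "real \<Rightarrow> (real \<times> real \<Rightarrow> real) \<Rightarrow> real \<Rightarrow> real" where
  "radon \<theta> f t = (LINT s:{- sqrt (1 - t\<^sup>2)..sqrt (1 - t\<^sup>2)}|lebesgue.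
     f (t * cos \<theta> - s * sin \<theta>, t * sin \<theta> + s * cos \<theta>))"

text \<open>\<open>radon \<theta> f t\<close> is a meaningful value only where the following holds;
  the Bochner integral is \<open>0\<close> otherwise.\<close>

definition radon_exists :: "real \<Rightarrow> (real \<times> real \<Rightarrow> real) \<Rightarrow> real \<Rightarrow> bool" where
  "radon_exists \<theta> f t \<longleftrightarrow> set_integrable lebesgue {- sqrt (1 - t\<^sup>2)..sqrt (1 - t\<^sup>2)}
     (\<lambda>s. f (t * cos \<theta> - s * sin \<theta>, t * sin \<theta> + s * cos \<theta>))"

definition is_cheb_U :: "nat \<Rightarrow> real poly \<Rightarrow> bool" where
  "is_cheb_U k p \<longleftrightarrow>
     (\<forall>\<theta>. sin \<theta> \<noteq> 0 \<longrightarrow> poly p (cos \<theta>) = sin (real (k + 1) * \<theta>) / sin \<theta>)"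

definition cheb_U :: "nat \<Rightarrow> real poly" where
  "cheb_U k = (THE p. is_cheb_U k p)"

lemma is_cheb_U_exists: "\<exists>p. is_cheb_U k p"
proof (induction k rule: less_induct)
  case (less k)
  consider "k = 0" | "k = 1" | j where "k = Suc (Suc j)"
    by (metis One_nat_def not0_implies_Suc)
  then show ?case
  proof cases
    case 1
    then show ?thesis by (intro exI[of _ 1]) (simp add: is_cheb_U_def)
  next
    case 2
    then show ?thesis
      by (intro exI[of _ "[:0, 2:]"]) (simp add: is_cheb_U_def sin_double)
  next
    case 3
    obtain p q where p: "is_cheb_U j p" and q: "is_cheb_U (Suc j) q"
      using less 3 by (metis lessI less_SucI)
    have "is_cheb_U k ([:0, 2:] * q - p)"
      unfolding is_cheb_U_def
    proof (intro allI impI)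
      fix \<theta> :: real
      assume s: "sin \<theta> \<noteq> 0"
      let ?a = "real (j + 2) * \<theta>"
      have "sin (?a + \<theta>) + sin (?a - \<theta>) = 2 * cos \<theta> * sin ?a"
        by (simp add: sin_add sin_diff)
      moreover have "?a + \<theta> = real (k + 1) * \<theta>" "?a - \<theta> = real (j + 1) * \<theta>"
        using 3 by (simp_all add: algebra_simps)
      ultimately have "sin (real (k + 1) * \<theta>)
          = 2 * cos \<theta> * sin ?a - sin (real (j + 1) * \<theta>)" by simp
      moreover have "poly p (cos \<theta>) = sin (real (j + 1) * \<theta>) / sin \<theta>"
        using p s unfolding is_cheb_U_def by blast
      moreover have "poly q (cos \<theta>) = sin ?a / sin \<theta>"
        using q s unfolding is_cheb_U_def by simp
      ultimately show "poly ([:0, 2:] * q - p) (cos \<theta>) = sin (real (k + 1) * \<theta>) / sin \<theta>"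
        by (simp add: diff_divide_distrib mult.assoc)
    qed
    then show ?thesis by blast
  qed
qed

lemma is_cheb_U_unique:
  assumes "is_cheb_U k p" "is_cheb_U k q"
  shows "p = q"
proof (rule ccontr)
  assume "p \<noteq> q"
  then have fin: "finite {x. poly (p - q) x = 0}" by (intro poly_roots_finite) simp
  have "{-1<..<1} \<subseteq> {x. poly (p - q) x = 0}"
  proof
    fix x :: real
    assume "x \<in> {-1<..<1}"
    then have x: "-1 < x" "x < 1" by auto
    then have "sin (arccos x) \<noteq> 0" by (rule sin_arccos_nonzero)
    then have "poly p (cos (arccos x)) = poly q (cos (arccos x))"
      using assms unfolding is_cheb_U_def by simp
    then show "x \<in> {x. poly (p - q) x = 0}" using x by simp
  qed
  then have "finite {-1<..<1::real}" using fin by (rule finite_subset)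
  then show False using infinite_Ioo[of "-1::real" 1] by simp
qed

lemma is_cheb_U_cheb_U: "is_cheb_U k (cheb_U k)"
  unfolding cheb_U_def using is_cheb_U_exists is_cheb_U_unique by (metis theI)

definition ridge_U :: "nat \<Rightarrow> real \<Rightarrow> real \<times> real \<Rightarrow> real" where
  "ridge_U k \<theta> = (\<lambda>(x, y). poly (cheb_U k) (x * cos \<theta> + y * sin \<theta>))"

text \<open>Bivariate polynomials are represented by their polynomial functions on the whole plane.\<close>

definition poly2 :: "nat \<Rightarrow> (real \<times> real \<Rightarrow> real) set" where
  "poly2 n = {P. \<exists>c. P = (\<lambda>(x, y). \<Sum>i\<le>n. \<Sum>j\<le>n - i. c i j * x ^ i * y ^ j)}"

text \<open>Polynomials of degree less than \<open>k\<close> are those in \<open>poly2 j\<close> for some \<open>j < k\<close>; for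
  \<open>k = 0\<close> there are none to be orthogonal to, as with the usual convention that the
  polynomials of degree at most \<open>-1\<close> form the zero space.\<close>

definition orth_poly2 :: "nat \<Rightarrow> (real \<times> real \<Rightarrow> real) set" where
  "orth_poly2 k = {P. (P \<in> poly2 k - (\<Union>j<k. poly2 j) \<or> P = (\<lambda>_. 0)) \<and>
     (\<forall>Q \<in> (\<Union>j<k. poly2 j). (LINT p:disc|lebesgue. P p * Q p) = 0)}"

definition proj :: "nat \<Rightarrow> (real \<times> real \<Rightarrow> real) \<Rightarrow> real \<times> real \<Rightarrow> real" where
  "proj k f = (THE P. P \<in> orth_poly2 k \<and>
     (\<forall>Q \<in> orth_poly2 k. (LINT p:disc|lebesgue. (f p - P p) * Q p) = 0))"

definition partial_sum :: "nat \<Rightarrow> (real \<times> real \<Rightarrow> real) \<Rightarrow> real \<times> real \<Rightarrow> real" where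
  "partial_sum n f = (\<lambda>p. \<Sum>k\<le>n. proj k f p)"

definition node :: "nat \<Rightarrow> nat \<Rightarrow> real" where
  "node m \<nu> = 2 * pi * real \<nu> / real (2 * m + 1)"

definition Phi :: "nat \<Rightarrow> nat \<Rightarrow> real \<Rightarrow> real \<times> real \<Rightarrow> real" where
  "Phi m \<nu> t p = 1 / real (2 * m + 1) *
     (\<Sum>k\<le>2 * m. real (k + 1) * poly (cheb_U k) t * ridge_U k (node m \<nu>) p)"

end

theory Submission
  imports Defs
begin

text \<open>Integrating \<open>U k (x cos \<phi> + y sin \<phi>)\<close> over a chord in direction \<open>\<theta>\<close> gives
  \<open>2 / (k + 1) * sqrt (1 - t\<^sup>2) * U k t * U k (cos (\<phi> - \<theta>))\<close>. By Fubini in rotated coordinates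
  and the orthogonality of the \<open>U k\<close> with respect to \<open>sqrt (1 - t\<^sup>2)\<close>, the ridge polynomials lie
  in \<open>orth_poly2 k\<close>, and their inner products are \<open>pi / (k + 1) * U k (cos (\<theta> - \<phi>))\<close>. They span,
  because an element of \<open>orth_poly2 k\<close> orthogonal to all of them is orthogonal to all powers
  \<open>(x cos \<theta> + y sin \<theta>) ^ k\<close>, hence to all monomials of degree \<open>k\<close>, hence to itself.
  Equidistant quadrature with the odd number \<open>2 * m + 1\<close> of nodes reproduces
  \<open>(x cos \<theta> + y sin \<theta>) ^ k\<close> for \<open>k \<le> 2 * m\<close>, so \<open>proj k f\<close> is, up to the factor
  \<open>(k + 1) / (pi * (2 * m + 1))\<close>, the sum over the nodes of the ridge polynomials weighted by
  their inner products with \<open>f\<close>, and those are integrals of the Radon projections.\<close>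

subsection \<open>Rotations of the plane\<close>

definition rot :: "real \<Rightarrow> real \<times> real \<Rightarrow> real \<times> real" where
  "rot \<theta> = (\<lambda>(t, s). (t * cos \<theta> - s * sin \<theta>, t * sin \<theta> + s * cos \<theta>))"

lemma measurable_plane_map:
  "(\<lambda>(x, y). (a * x + b * y, c * x + d * y)) \<in> (borel :: (real \<times> real) measure) \<rightarrow>\<^sub>M borel"
  by (intro borel_measurable_continuous_onI continuous_intros)
     (simp add: case_prod_unfold, intro continuous_intros)

text \<open>By Tonelli it suffices to look at each fixed \<open>y\<close>, where the shear is
  translation by \<open>a * y\<close>, and translations preserve one-dimensional Lebesgue
  measure.\<close>

lemma lborel_shear_fst:
  "distr lborel borel (\<lambda>(x, y). (x + a * y, y)) = (lborel :: (real \<times> real) measure)"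
  (is "?M = _")
proof (rule measure_eqI)
  fix A assume "A \<in> sets ?M"
  then have [measurable]: "A \<in> sets borel" by simp
  have [measurable]: "A \<in> sets (borel \<Otimes>\<^sub>M borel)" unfolding borel_prod by simp
  have m: "(\<lambda>(x, y). (x + a * y, y)) \<in> borel_measurable (borel :: (real \<times> real) measure)"
    using measurable_plane_map[of 1 a 0 1] by simp
  have "emeasure ?M A
      = (\<integral>\<^sup>+p. indicator A (fst p + a * snd p, snd p) \<partial>(lborel \<Otimes>\<^sub>M lborel))"
    using m by (simp add: nn_integral_indicator[symmetric] nn_integral_distr case_prod_unfold lborel_prod
        del: nn_integral_indicator)
  also have "\<dots> = (\<integral>\<^sup>+y. \<integral>\<^sup>+x. indicator A (x + a * y, y) \<partial>lborel \<partial>lborel)"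
    by (subst lborel_pair.nn_integral_snd[symmetric]) (simp_all add: case_prod_unfold)
  also have "\<dots> = (\<integral>\<^sup>+y. \<integral>\<^sup>+x. indicator A (x, y) \<partial>lborel \<partial>lborel)"
  proof (rule nn_integral_cong)
    fix y :: real
    show "(\<integral>\<^sup>+x. indicator A (x + a * y, y) \<partial>lborel) = (\<integral>\<^sup>+x. indicator A (x, y) \<partial>lborel)"
      by (subst (2) nn_integral_real_affine[where c = 1 and t = "a * y"]) (simp_all add: add.commute)
  qed
  also have "\<dots> = (\<integral>\<^sup>+p. indicator A p \<partial>(lborel \<Otimes>\<^sub>M lborel))"
    using lborel_pair.nn_integral_snd[of "\<lambda>p. indicator A p"] by simp
  also have "\<dots> = emeasure lborel A" by (simp add: lborel_prod)
  finally show "emeasure ?M A = emeasure lborel A" .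
qed simp

lemma lborel_swap: "distr lborel borel (\<lambda>(x, y). (y, x)) = (lborel :: (real \<times> real) measure)"
proof -
  have "distr (lborel \<Otimes>\<^sub>M lborel) (lborel \<Otimes>\<^sub>M lborel) (\<lambda>(x, y). (y, x)) = (lborel \<Otimes>\<^sub>M lborel :: (real \<times> real) measure)"
    by (rule lborel_pair.distr_pair_swap[symmetric])
  then have "distr lborel lborel (\<lambda>(x, y). (y, x)) = (lborel :: (real \<times> real) measure)"
    unfolding lborel_prod .
  moreover have "distr lborel borel (\<lambda>(x, y). (y, x)) = distr lborel (lborel :: (real \<times> real) measure) (\<lambda>(x, y). (y, x))"
    by (rule distr_cong) simp_all
  ultimately show ?thesis by simp
qed

lemma lborel_compose:
  assumes "distr lborel borel g = (lborel :: (real \<times> real) measure)"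
    and "distr lborel borel h = (lborel :: (real \<times> real) measure)"
    and "g \<in> borel \<rightarrow>\<^sub>M borel" "h \<in> borel \<rightarrow>\<^sub>M borel"
  shows "distr lborel borel (g \<circ> h) = (lborel :: (real \<times> real) measure)"
proof -
  have "distr (distr lborel borel h) borel g = distr lborel borel (g \<circ> h)"
    by (rule distr_distr) (use assms(3,4) in simp_all)
  then show ?thesis unfolding assms(1,2) by (rule sym)
qed

lemma measurable_rot[measurable]: "rot \<theta> \<in> borel \<rightarrow>\<^sub>M borel"
proof -
  have "rot \<theta> = (\<lambda>(x, y). (cos \<theta> * x + (- sin \<theta>) * y, sin \<theta> * x + cos \<theta> * y))"
    by (auto simp: rot_def algebra_simps)
  then show ?thesis by (simp only: measurable_plane_map)
qed

text \<open>Conjugating the horizontal shear by the coordinate swap gives the vertical one, and both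
  factors preserve the measure.\<close>

lemma lborel_shear_snd:
  "distr lborel borel (\<lambda>(x, y). (x, y + b * x)) = (lborel :: (real \<times> real) measure)"
proof -
  let ?w = "\<lambda>(x, y). (y, x) :: real \<times> real" and ?h = "\<lambda>(x, y). (x + b * y, y)"
  have w: "?w \<in> borel \<rightarrow>\<^sub>M borel" using measurable_plane_map[of 0 1 1 0] by simp
  have h: "?h \<in> borel \<rightarrow>\<^sub>M borel" using measurable_plane_map[of 1 b 0 1] by simp
  have "distr lborel borel (?w \<circ> (?h \<circ> ?w)) = (lborel :: (real \<times> real) measure)"
    by (intro lborel_compose lborel_swap lborel_shear_fst w h measurable_comp[OF w h])
  moreover have "?w \<circ> (?h \<circ> ?w) = (\<lambda>(x, y). (x, y + b * x))" by auto
  ultimately show ?thesis by simp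
qed

lemma rot_add: "rot (\<alpha> + \<beta>) = rot \<alpha> \<circ> rot \<beta>"
  by (auto simp: rot_def fun_eq_iff cos_add sin_add algebra_simps)

text \<open>A rotation is a product of three shears, except through an angle that is an odd multiple of
  \<open>pi\<close>, where two quarter turns are composed instead.\<close>

lemma lborel_rot: "distr lborel borel (rot \<theta>) = lborel"
proof -
  have main: "distr lborel borel (rot \<theta>) = lborel" if c: "1 + cos \<theta> \<noteq> 0" for \<theta>
  proof -
    \<comment> \<open>This is \<open>- tan (\<theta> / 2)\<close>, the coefficient of both
      horizontal shears in the three-shear factorization; the vertical shear between them has
      coefficient \<open>sin \<theta>\<close>.\<close>
    define a where "a = - sin \<theta> / (1 + cos \<theta>)"
    let ?g = "\<lambda>(x, y). (x + a * y, y)" and ?h = "\<lambda>(x, y). (x, y + sin \<theta> * x)"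
    have g: "?g \<in> borel \<rightarrow>\<^sub>M borel" using measurable_plane_map[of 1 a 0 1] by simp
    have h: "?h \<in> borel \<rightarrow>\<^sub>M borel" using measurable_plane_map[of 1 0 "sin \<theta>" 1] by (simp add: add.commute)
    have a1: "a * (1 + cos \<theta>) = - sin \<theta>" using c by (simp add: a_def)
    have "(1 + cos \<theta>) * (1 + a * sin \<theta> - cos \<theta>) = 0"
      using a1 sin_cos_squared_add[of \<theta>] by algebra
    then have a2: "1 + a * sin \<theta> = cos \<theta>" using c by simp
    have "?g \<circ> (?h \<circ> ?g) = rot \<theta>"
    proof (rule ext)
      fix p :: "real \<times> real"
      obtain x y where p: "p = (x, y)" by (cases p)
      have "x + a * y + a * (y + sin \<theta> * (x + a * y)) = x * (1 + a * sin \<theta>) + y * (a * (1 + (1 + a * sin \<theta>)))"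
        by (simp add: algebra_simps)
      then have 1: "x + a * y + a * (y + sin \<theta> * (x + a * y)) = x * cos \<theta> - y * sin \<theta>"
        using a1 a2 by simp
      have "y + sin \<theta> * (x + a * y) = x * sin \<theta> + y * (1 + a * sin \<theta>)" by (simp add: algebra_simps)
      with 1 a2 show "(?g \<circ> (?h \<circ> ?g)) p = rot \<theta> p" by (simp add: p rot_def)
    qed
    moreover have "distr lborel borel (?g \<circ> (?h \<circ> ?g)) = lborel"
      by (intro lborel_compose lborel_shear_fst lborel_shear_snd g h measurable_comp[OF g h])
    ultimately show ?thesis by simp
  qed
  show ?thesis
  proof (cases "1 + cos \<theta> = 0")
    case True
    then have c: "cos \<theta> = -1" by simp
    then have s: "sin \<theta> = 0" using sin_cos_squared_add[of \<theta>] by simp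
    have "rot \<theta> = rot (pi / 2) \<circ> rot (pi / 2)"
      by (subst rot_add[symmetric]) (simp add: rot_def c s)
    then show ?thesis by (simp add: lborel_compose main)
  qed (rule main)
qed

section \<open>The disc: rotation invariance, slices and lines\<close>

lemma disc_rot: "rot \<theta> p \<in> disc \<longleftrightarrow> p \<in> disc"
proof -
  obtain t s where p: "p = (t, s)" by (cases p)
  have "(t * cos \<theta> - s * sin \<theta>)\<^sup>2 + (t * sin \<theta> + s * cos \<theta>)\<^sup>2
      = (t\<^sup>2 + s\<^sup>2) * ((sin \<theta>)\<^sup>2 + (cos \<theta>)\<^sup>2)" by algebra
  then show ?thesis by (simp add: p rot_def disc_def)
qed

text \<open>Identifies the slice of the disc over \<open>t\<close> with the integration interval in
  \<open>radon\<close>, so that Fubini over the disc produces Radon projections.\<close>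

lemma mem_disc_iff: "(t, s) \<in> disc \<longleftrightarrow> t \<in> {-1..1} \<and> s \<in> {- sqrt (1 - t\<^sup>2)..sqrt (1 - t\<^sup>2)}"
proof -
  have "t\<^sup>2 + s\<^sup>2 \<le> 1 \<longleftrightarrow> \<bar>t\<bar> \<le> 1 \<and> \<bar>s\<bar> \<le> sqrt (1 - t\<^sup>2)"
  proof
    assume *: "t\<^sup>2 + s\<^sup>2 \<le> 1"
    then have "t\<^sup>2 \<le> 1" using zero_le_power2[of s] by linarith
    moreover have "s\<^sup>2 \<le> 1 - t\<^sup>2" using * by simp
    ultimately show "\<bar>t\<bar> \<le> 1 \<and> \<bar>s\<bar> \<le> sqrt (1 - t\<^sup>2)"
      by (auto simp: abs_square_le_1 intro: real_le_rsqrt)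
  next
    assume *: "\<bar>t\<bar> \<le> 1 \<and> \<bar>s\<bar> \<le> sqrt (1 - t\<^sup>2)"
    then have "t\<^sup>2 \<le> 1" by (simp add: abs_square_le_1)
    moreover have "\<bar>s\<bar>\<^sup>2 \<le> (sqrt (1 - t\<^sup>2))\<^sup>2" using * by (intro power_mono) auto
    ultimately show "t\<^sup>2 + s\<^sup>2 \<le> 1" by simp
  qed
  then show ?thesis by (auto simp: disc_def abs_le_iff)
qed

lemma disc_eq_cball: "disc = cball 0 1"
  by (auto simp: disc_def cball_def dist_norm norm_Pair)

lemma disc_sets [measurable]: "disc \<in> sets borel" "disc \<in> sets lebesgue"
  by (simp_all add: disc_eq_cball)

lemma disc_compact: "compact disc"
  by (simp add: disc_eq_cball)

text \<open>A rotation carries null sets to null sets, and almost every slice of a null set is null.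
  Hence changing a function on a null set of the plane affects only a null set of parallel
  lines.\<close>

lemma AE_rot_lines:
  assumes "AE p in lborel. Q p"
  shows "AE t in lborel. AE s in lborel. Q (rot \<theta> (t, s))"
proof -
  have "AE p in distr lborel borel (rot \<theta>). Q p" using assms unfolding lborel_rot .
  then have "AE p in lborel. Q (rot \<theta> p)"
    using AE_distrD[of "rot \<theta>" lborel borel Q] by simp
  then show ?thesis using lborel_pair.AE_pair unfolding lborel_prod by blast
qed

subsection \<open>Chebyshev polynomials of the second kind\<close>

abbreviation U :: "nat \<Rightarrow> real \<Rightarrow> real" where "U k t \<equiv> poly (cheb_U k) t"

lemma U_cos: "sin \<theta> \<noteq> 0 \<Longrightarrow> U k (cos \<theta>) = sin (real (k + 1) * \<theta>) / sin \<theta>"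
  using is_cheb_U_cheb_U[of k] unfolding is_cheb_U_def by blast

lemma cheb_U_eqI: "is_cheb_U k p \<Longrightarrow> cheb_U k = p"
  by (rule is_cheb_U_unique[OF is_cheb_U_cheb_U])

lemma cheb_U_0 [simp]: "cheb_U 0 = 1"
  by (rule cheb_U_eqI) (simp add: is_cheb_U_def)

lemma cheb_U_1 [simp]: "cheb_U (Suc 0) = [:0, 2:]"
  by (rule cheb_U_eqI) (simp add: is_cheb_U_def sin_double)

text \<open>The sine addition formulas give the three-term recurrence at every
  \<open>cos \<theta>\<close> with \<open>sin \<theta> \<noteq> 0\<close>; uniqueness of the
  polynomial in \<open>is_cheb_U\<close> makes it an identity of polynomials.\<close>

lemma cheb_U_rec: "cheb_U (Suc (Suc k)) = [:0, 2:] * cheb_U (Suc k) - cheb_U k"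
proof (rule cheb_U_eqI, unfold is_cheb_U_def, intro allI impI)
  fix \<theta> :: real
  assume s: "sin \<theta> \<noteq> 0"
  have "sin (real (k + 2) * \<theta> + \<theta>) + sin (real (k + 2) * \<theta> - \<theta>) = 2 * cos \<theta> * sin (real (k + 2) * \<theta>)"
    by (simp add: sin_add sin_diff)
  moreover have "real (k + 2) * \<theta> + \<theta> = real (Suc (Suc k) + 1) * \<theta>" "real (k + 2) * \<theta> - \<theta> = real (k + 1) * \<theta>"
    by (simp_all add: algebra_simps)
  ultimately have "sin (real (Suc (Suc k) + 1) * \<theta>) = 2 * cos \<theta> * sin (real (k + 2) * \<theta>) - sin (real (k + 1) * \<theta>)"
    by simp
  then show "poly ([:0, 2:] * cheb_U (Suc k) - cheb_U k) (cos \<theta>) = sin (real (Suc (Suc k) + 1) * \<theta>) / sin \<theta>"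
    using U_cos[OF s, of k] U_cos[OF s, of "Suc k"] by (simp add: diff_divide_distrib)
qed

lemma U_rec: "U (Suc (Suc k)) t = 2 * t * U (Suc k) t - U k t"
  by (simp add: cheb_U_rec)

text \<open>Each step of the recurrence multiplies by \<open>[:0, 2:]\<close>, raising the degree by
  one and doubling the leading coefficient.\<close>

lemma degree_cheb_U: "degree (cheb_U k) = k"
  and lead_coeff_cheb_U: "coeff (cheb_U k) k = 2 ^ k"
proof -
  have "degree (cheb_U k) \<le> k \<and> coeff (cheb_U k) k = 2 ^ k"
  proof (induction k rule: induct_nat_012)
    case (ge2 k)
    have "degree ([:0, 2:] * cheb_U (Suc k)) \<le> Suc (Suc k)"
      using degree_mult_le[of "[:0, 2:]" "cheb_U (Suc k)"] ge2 by simp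
    then have "degree (cheb_U (Suc (Suc k))) \<le> Suc (Suc k)"
      unfolding cheb_U_rec using ge2 by (intro degree_diff_le) auto
    moreover have "coeff (cheb_U k) (Suc (Suc k)) = 0"
      using ge2 by (intro coeff_eq_0) auto
    ultimately show ?case using ge2 by (simp add: cheb_U_rec)
  qed auto
  then show "degree (cheb_U k) = k" "coeff (cheb_U k) k = 2 ^ k"
    by (auto intro!: antisym le_degree)
qed

lemma U_at_1: "U k 1 = real (k + 1)"
  by (induction k rule: induct_nat_012) (auto simp: U_rec)

lemma U_minus: "U k (- t) = (-1) ^ k * U k t"
  by (induction k rule: induct_nat_012) (auto simp: U_rec algebra_simps)

text \<open>Multiplying out the denominator extends the defining formula to all angles: at integer
  multiples of \<open>pi\<close> both sides vanish.\<close>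

lemma sin_times_U: "sin \<theta> * U k (cos \<theta>) = sin (real (k + 1) * \<theta>)"
proof (cases "sin \<theta> = 0")
  case True
  then obtain i :: int where "\<theta> = of_int i * pi" using sin_zero_iff_int2 by blast
  then have "real (k + 1) * \<theta> = of_int (int (k + 1) * i) * pi" by (simp add: algebra_simps)
  then show ?thesis using True sin_zero_iff_int2 by (metis mult_zero_left)
qed (simp add: U_cos)

text \<open>This is \<open>sin ((k + 1) * \<beta>) / sin \<beta>\<close> written as a geometric sum
  with frequencies \<open>-k, -k + 2, ..., k\<close>. Arguing by the recurrence covers the zeros of
  \<open>sin \<beta>\<close> as well.\<close>

lemma U_cos_cis: "complex_of_real (U k (cos \<beta>)) = (\<Sum>l\<le>k. cis ((2 * real l - real k) * \<beta>))"
proof -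
  define F where "F = (\<lambda>k::nat. \<Sum>l\<le>k. cis ((2 * real l - real k) * \<beta>))"
  have up: "F (Suc k) = cis (- \<beta>) * F k + cis (real (Suc k) * \<beta>)" for k
    by (simp add: F_def sum_distrib_left cis_mult algebra_simps)
  have dn: "F (Suc k) = cis \<beta> * F k + cis (- (real (Suc k) * \<beta>))" for k
    unfolding F_def sum.atMost_Suc_shift by (simp add: sum_distrib_left cis_mult algebra_simps flip: minus_add_distrib)
  \<comment> \<open>Multiplying \<open>dn\<close> at \<open>k\<close> by
    \<open>cis (- \<beta>)\<close> yields the same boundary term as \<open>dn\<close> at
    \<open>Suc k\<close>; eliminating it leaves the recurrence of \<open>U\<close>.\<close>
  have "F (Suc (Suc k)) = complex_of_real (2 * cos \<beta>) * F (Suc k) - F k" for k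
  proof -
    have "cis \<beta> * cis (- \<beta>) = 1" by (simp add: cis_mult)
    moreover have "cis (- \<beta>) * cis (-(real (Suc k) * \<beta>)) = cis (- (real (Suc (Suc k)) * \<beta>))"
      unfolding cis_mult by (rule arg_cong[where f = cis]) (simp add: algebra_simps)
    moreover have "cis \<beta> + cis (- \<beta>) = complex_of_real (2 * cos \<beta>)"
      by (simp add: complex_eq_iff)
    ultimately show ?thesis using dn[of k] dn[of "Suc k"] by algebra
  qed
  then have "complex_of_real (U k (cos \<beta>)) = F k"
  proof (induction k rule: induct_nat_012)
    case 1
    show ?case by (simp add: F_def complex_eq_iff)
  next
    case 0
    show ?case by (simp add: F_def)
  qed (simp add: U_rec)
  then show ?thesis by (simp add: F_def)
qed

section \<open>Integrals of \<open>U k\<close>: weighted moments and chords\<close>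

lemma has_integral_U_sqrt:
  "((\<lambda>t. U k t * sqrt (1 - t\<^sup>2)) has_integral (if k = 0 then pi / 2 else 0)) {-1..1}"
proof -
  \<comment> \<open>With \<open>t = cos \<tau>\<close> the integrand becomes
    \<open>- sin ((k + 1) * \<tau>) * sin \<tau>\<close>. The product-to-sum formula gives this
    antiderivative; for \<open>k = 0\<close> the second cosine is constant and contributes
    \<open>\<tau> / 2\<close>, the only term that survives at the endpoints.\<close>
  define A where "A = (\<lambda>\<tau>. sin (real (k + 2) * \<tau>) / (2 * real (k + 2))
     - (if k = 0 then \<tau> / 2 else sin (real k * \<tau>) / (2 * real k)))"
  have dA: "(A has_real_derivative - (sin (real (k + 1) * \<tau>) * sin \<tau>)) (at \<tau>)" for \<tau>
  proof -
    have "cos (real (k + 1) * \<tau> + \<tau>) - cos (real (k + 1) * \<tau> - \<tau>) = - 2 * (sin (real (k + 1) * \<tau>) * sin \<tau>)"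
      by (simp add: cos_add cos_diff)
    then have "cos (real (k + 2) * \<tau>) / 2 - cos (real k * \<tau>) / 2 = - (sin (real (k + 1) * \<tau>) * sin \<tau>)"
      by (simp add: algebra_simps)
    moreover have "(A has_real_derivative cos (real (k + 2) * \<tau>) / 2 - cos (real k * \<tau>) / 2) (at \<tau>)"
    proof -
      have S: "((\<lambda>\<tau>. sin (c * \<tau>) / (2 * c)) has_real_derivative cos (c * \<tau>) / 2) (at \<tau>)" if "c \<noteq> 0" for c
        by (rule DERIV_cong[OF DERIV_cdivide[OF DERIV_chain2[OF DERIV_sin DERIV_cmult_Id]]]) (use that in simp)
      show ?thesis
      proof (cases "k = 0")
        case True
        then show ?thesis
          unfolding A_def using S[of 2] by (auto intro!: derivative_eq_intros)
      next
        case False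
        then show ?thesis
          unfolding A_def using DERIV_diff[OF S[of "real (k + 2)"] S[of "real k"]] by simp
      qed
    qed
    ultimately show ?thesis by simp
  qed
  \<comment> \<open>Since \<open>arccos\<close> is not differentiable at -1 and 1, the version of
    the fundamental theorem is used that asks only for continuity at the endpoints.\<close>
  have "((\<lambda>t. U k t * sqrt (1 - t\<^sup>2)) has_integral (A (arccos 1) - A (arccos (-1)))) {-1..1}"
  proof (rule fundamental_theorem_of_calculus_interior)
    have "continuous_on UNIV A"
      using dA by (meson DERIV_isCont continuous_at_imp_continuous_on)
    then show "continuous_on {-1..1} (\<lambda>t. A (arccos t))"
      by (rule continuous_on_compose2) (auto intro: continuous_intros)
    fix t :: real assume t: "t \<in> {-1<..<1}"
    then have s: "sin (arccos t) = sqrt (1 - t\<^sup>2)" "sin (arccos t) \<noteq> 0" and c: "cos (arccos t) = t"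
      using sin_arccos_nonzero by (auto simp: sin_arccos)
    have "U k t = sin (real (k + 1) * arccos t) / sin (arccos t)"
      using U_cos[OF s(2), of k] c by simp
    then have "- (sin (real (k + 1) * arccos t) * sin (arccos t)) * inverse (- sqrt (1 - t\<^sup>2)) = U k t * sqrt (1 - t\<^sup>2)"
      using s by (simp add: field_simps)
    moreover have "((\<lambda>t. A (arccos t)) has_real_derivative
        - (sin (real (k + 1) * arccos t) * sin (arccos t)) * inverse (- sqrt (1 - t\<^sup>2))) (at t)"
      by (rule DERIV_chain2[OF dA DERIV_arccos]) (use t in auto)
    ultimately show "((\<lambda>t. A (arccos t)) has_vector_derivative U k t * sqrt (1 - t\<^sup>2)) (at t)"
      by (simp add: has_real_derivative_iff_has_vector_derivative)
  qed simp
  moreover have "A (arccos 1) - A (arccos (-1)) = (if k = 0 then pi / 2 else 0)"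
  proof -
    have "sin (real k * pi) = 0" "sin (real (k + 2) * pi) = 0" by (simp_all only: sin_npi)
    then show ?thesis by (auto simp: A_def)
  qed
  ultimately show ?thesis by simp
qed

text \<open>Each factor \<open>t\<close> is absorbed by
  \<open>t * U (j + 1) t = (U (j + 2) t + U j t) / 2\<close>, lowering the index by at most one.
  Index 0 is reached only if \<open>n = k\<close>, along a single path that collects
  \<open>k\<close> halvings of \<open>pi / 2\<close>.\<close>

lemma has_integral_moment_U_sqrt:
  "n \<le> k \<Longrightarrow> ((\<lambda>t. t ^ n * U k t * sqrt (1 - t\<^sup>2)) has_integral (if n = k then pi / 2 ^ (k + 1) else 0)) {-1..1}"
proof (induction n arbitrary: k)
  case 0
  then show ?case using has_integral_U_sqrt[of k] by (cases "k = 0") simp_all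
next
  case (Suc n)
  then obtain j where k: "k = Suc j" "n \<le> j" by (cases k) auto
  have rec: "t * U (Suc j) t = (U (Suc (Suc j)) t + U j t) / 2" for t by (simp add: U_rec)
  have eq: "t ^ Suc n * U k t * sqrt (1 - t\<^sup>2)
      = (t ^ n * U (Suc (Suc j)) t * sqrt (1 - t\<^sup>2) + t ^ n * U j t * sqrt (1 - t\<^sup>2)) / 2" for t
  proof -
    have "t ^ Suc n * U k t = t ^ n * (t * U (Suc j) t)" by (simp add: k)
    then show ?thesis unfolding rec by (simp add: algebra_simps add_divide_distrib)
  qed
  have "((\<lambda>t. (t ^ n * U (Suc (Suc j)) t * sqrt (1 - t\<^sup>2) + t ^ n * U j t * sqrt (1 - t\<^sup>2)) / 2)
      has_integral (0 + (if n = j then pi / 2 ^ (j + 1) else 0)) / 2) {-1..1}"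
    using Suc.IH[of "Suc (Suc j)"] Suc.IH[of j] k
    by (intro has_integral_divide has_integral_add) auto
  then show ?case unfolding eq using k by (auto split: if_splits)
qed

lemma integral_U_power_sqrt:
  "n \<le> k \<Longrightarrow> (LINT t:{-1..1}|lebesgue. t ^ n * U k t * sqrt (1 - t\<^sup>2)) = (if n = k then pi / 2 ^ (k + 1) else 0)"
proof -
  assume "n \<le> k"
  have "set_integrable lebesgue {-1..1} (\<lambda>t. t ^ n * U k t * sqrt (1 - t\<^sup>2))"
    by (intro absolutely_integrable_continuous_real continuous_intros)
  then show ?thesis using has_integral_moment_U_sqrt[OF \<open>n \<le> k\<close>]
    by (simp add: set_lebesgue_integral_eq_integral integral_unique)
qed

text \<open>The antiderivative is, up to a constant, the Chebyshev polynomial of the first kind.\<close>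

lemma U_antiderivative:
  obtains V where "\<And>x. (V has_real_derivative U k x) (at x)"
    and "\<And>\<alpha> \<beta>. V (cos \<alpha>) - V (cos \<beta>) = (cos (real (k + 1) * \<alpha>) - cos (real (k + 1) * \<beta>)) / real (k + 1)"
proof -
  define V where "V = (\<lambda>x. \<Sum>i\<le>k. coeff (cheb_U k) i * (x ^ Suc i / real (Suc i)))"
  have V: "(V has_real_derivative U k x) (at x)" for x
    unfolding V_def poly_altdef degree_cheb_U
  proof (rule DERIV_sum)
    fix i
    have "((\<lambda>x. x ^ Suc i / real (Suc i)) has_real_derivative real (Suc i) * x ^ i / real (Suc i)) (at x)"
      by (rule DERIV_cdivide, rule DERIV_cong[OF DERIV_pow]) simp
    then have "((\<lambda>x. x ^ Suc i / real (Suc i)) has_real_derivative x ^ i) (at x)" by simp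
    then show "((\<lambda>x. coeff (cheb_U k) i * (x ^ Suc i / real (Suc i))) has_real_derivative
        coeff (cheb_U k) i * x ^ i) (at x)"
      by (rule DERIV_cmult)
  qed
  \<comment> \<open>Both terms have the same derivative by \<open>sin_times_U\<close>, so
    \<open>g\<close> is constant and differences of \<open>V (cos \<tau>)\<close> are differences of
    cosines.\<close>
  define g where "g = (\<lambda>\<tau>. V (cos \<tau>) - cos (real (k + 1) * \<tau>) / real (k + 1))"
  have "(g has_real_derivative 0) (at \<tau>)" for \<tau>
  proof -
    have "((\<lambda>\<tau>. V (cos \<tau>)) has_real_derivative U k (cos \<tau>) * - sin \<tau>) (at \<tau>)"
      by (rule DERIV_chain2[OF V DERIV_cos])
    moreover have "((\<lambda>\<tau>. cos (real (k + 1) * \<tau>) / real (k + 1)) has_real_derivative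
        - sin (real (k + 1) * \<tau>) * real (k + 1) / real (k + 1)) (at \<tau>)"
      by (rule derivative_eq_intros refl | simp)+
    ultimately have "(g has_real_derivative U k (cos \<tau>) * - sin \<tau>
        - - sin (real (k + 1) * \<tau>) * real (k + 1) / real (k + 1)) (at \<tau>)"
      unfolding g_def by (rule DERIV_diff)
    then show ?thesis using sin_times_U[of \<tau> k] by (simp add: mult.commute)
  qed
  then have const: "g \<alpha> = g \<beta>" for \<alpha> \<beta> by (intro DERIV_isconst_all) simp
  have "V (cos \<alpha>) - V (cos \<beta>) = (cos (real (k + 1) * \<alpha>) - cos (real (k + 1) * \<beta>)) / real (k + 1)" for \<alpha> \<beta>
    using const[of \<alpha> \<beta>] unfolding g_def diff_divide_distrib by linarith
  with V show ?thesis by (rule that)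
qed

text \<open>With \<open>t = cos \<tau>\<close>, the argument of \<open>U k\<close> runs between
  \<open>cos (\<tau> + \<gamma>)\<close> and \<open>cos (\<tau> - \<gamma>)\<close>. The
  antiderivative turns the integral into a difference of cosines, which factors into
  \<open>sin ((k + 1) * \<tau>) * sin ((k + 1) * \<gamma>)\<close>, separating the two
  angles.\<close>

lemma integral_U_chord:
  assumes t: "t \<in> {-1..1}"
  shows "(LINT s:{- sqrt (1 - t\<^sup>2)..sqrt (1 - t\<^sup>2)}|lebesgue. U k (t * cos \<gamma> + s * sin \<gamma>))
     = 2 / real (k + 1) * sqrt (1 - t\<^sup>2) * U k t * U k (cos \<gamma>)"
proof -
  let ?r = "sqrt (1 - t\<^sup>2)"
  have r: "0 \<le> ?r" using t by (simp add: abs_square_le_1 abs_le_iff)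
  have li: "(LINT s:{-?r..?r}|lebesgue. U k (t * cos \<gamma> + s * sin \<gamma>)) = integral {-?r..?r} (\<lambda>s. U k (t * cos \<gamma> + s * sin \<gamma>))"
    by (intro set_lebesgue_integral_eq_integral(2) absolutely_integrable_continuous_real continuous_intros)
  show ?thesis
  proof (cases "sin \<gamma> = 0")
    case True
    \<comment> \<open>Here the integrand is constant along the chord. Parity and the endpoint value
      \<open>k + 1\<close> of \<open>U k\<close> at 1 supply the factor
      \<open>1 / (k + 1)\<close>.\<close>
    then have "cos \<gamma> = 1 \<or> cos \<gamma> = -1" by (metis cos_zero_iff_int sin_zero_abs_cos_one abs_1 abs_eq_iff)
    moreover have "(-1::real) ^ k * (-1) ^ k = 1" by (simp add: power_mult_distrib[symmetric])
    ultimately have "U k (t * cos \<gamma>) = U k t * U k (cos \<gamma>) / real (k + 1)"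
      using U_at_1[of k] U_minus[of k t] U_minus[of k 1] by auto
    then show ?thesis unfolding li using True r by simp
  next
    case False
    define \<tau> where "\<tau> = arccos t"
    have \<tau>: "cos \<tau> = t" "sin \<tau> = ?r" using t by (auto simp: \<tau>_def sin_arccos)
    obtain V where V: "\<And>x. (V has_real_derivative U k x) (at x)"
      and Vcos: "\<And>\<alpha> \<beta>. V (cos \<alpha>) - V (cos \<beta>) = (cos (real (k + 1) * \<alpha>) - cos (real (k + 1) * \<beta>)) / real (k + 1)"
      using U_antiderivative[of k] by blast
    have "((\<lambda>s. U k (t * cos \<gamma> + s * sin \<gamma>)) has_integral
        (V (t * cos \<gamma> + ?r * sin \<gamma>) / sin \<gamma> - V (t * cos \<gamma> + - ?r * sin \<gamma>) / sin \<gamma>)) {-?r..?r}"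
    proof (rule fundamental_theorem_of_calculus)
      fix s
      have "((\<lambda>s. V (t * cos \<gamma> + s * sin \<gamma>)) has_real_derivative U k (t * cos \<gamma> + s * sin \<gamma>) * sin \<gamma>) (at s)"
        by (rule DERIV_chain2[OF V]) (auto intro!: derivative_eq_intros)
      then have "((\<lambda>s. V (t * cos \<gamma> + s * sin \<gamma>) / sin \<gamma>) has_real_derivative U k (t * cos \<gamma> + s * sin \<gamma>) * sin \<gamma> / sin \<gamma>) (at s)"
        by (rule DERIV_cdivide)
      then show "((\<lambda>s. V (t * cos \<gamma> + s * sin \<gamma>) / sin \<gamma>) has_vector_derivative U k (t * cos \<gamma> + s * sin \<gamma>)) (at s within {-?r..?r})"
        using False by (simp add: has_real_derivative_iff_has_vector_derivative has_vector_derivative_at_within)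
    qed (use r in simp)
    moreover have "V (t * cos \<gamma> + ?r * sin \<gamma>) / sin \<gamma> - V (t * cos \<gamma> + - ?r * sin \<gamma>) / sin \<gamma>
        = 2 / real (k + 1) * ?r * U k t * U k (cos \<gamma>)"
    proof -
      have "t * cos \<gamma> + ?r * sin \<gamma> = cos (\<tau> - \<gamma>)" "t * cos \<gamma> + - ?r * sin \<gamma> = cos (\<tau> + \<gamma>)"
        using \<tau> by (simp_all add: cos_diff cos_add)
      then have "V (t * cos \<gamma> + ?r * sin \<gamma>) - V (t * cos \<gamma> + - ?r * sin \<gamma>)
          = (cos (real (k + 1) * \<tau> - real (k + 1) * \<gamma>) - cos (real (k + 1) * \<tau> + real (k + 1) * \<gamma>)) / real (k + 1)"
        using Vcos[of "\<tau> - \<gamma>" "\<tau> + \<gamma>"] by (simp only: right_diff_distrib distrib_left)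
      also have "\<dots> = 2 * (sin (real (k + 1) * \<tau>) * sin (real (k + 1) * \<gamma>)) / real (k + 1)"
        by (simp only: cos_diff cos_add) simp
      also have "\<dots> = 2 / real (k + 1) * ?r * U k t * U k (cos \<gamma>) * sin \<gamma>"
        using \<tau> by (simp only: sin_times_U[symmetric]) (simp add: algebra_simps)
      finally show ?thesis using False by (simp add: diff_divide_distrib[symmetric])
    qed
    ultimately have "((\<lambda>s. U k (t * cos \<gamma> + s * sin \<gamma>)) has_integral 2 / real (k + 1) * ?r * U k t * U k (cos \<gamma>)) {-?r..?r}"
      by simp
    then show ?thesis using li by (simp add: integral_unique)
  qed
qed

subsection \<open>Radon projections and Fubini\<close>

text \<open>The definitions integrate over the completion \<open>lebesgue\<close>, whereas Fubini is
  applied to the Borel product \<open>lborel\<close>. Modifying a function on a null set keeps it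
  measurable for the completion, so results pass from a Borel version back to the given
  function.\<close>

lemma lebesgue_integral_AE_lborel:
  fixes f g :: "'a::euclidean_space \<Rightarrow> real"
  assumes g: "integrable lborel g" and ae: "AE x in lborel. f x = g x"
  shows "integrable lebesgue f" "integral\<^sup>L lebesgue f = integral\<^sup>L lborel g"
proof -
  have gm: "g \<in> borel_measurable lebesgue"
    using g by (auto intro: measurable_completion)
  have ae': "AE x in lebesgue. g x = f x" using ae by (auto intro: AE_completion)
  have fm: "f \<in> borel_measurable lebesgue" by (rule borel_measurable_AE[OF gm ae'])
  have "integrable lebesgue g" using g by (simp add: integrable_completion)
  then show "integrable lebesgue f" by (rule integrable_cong_AE_imp[OF _ fm]) (use ae' in auto)
  have "integral\<^sup>L lebesgue f = integral\<^sup>L lebesgue g"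
    by (rule integral_cong_AE[OF fm gm]) (use ae' in auto)
  then show "integral\<^sup>L lebesgue f = integral\<^sup>L lborel g" using g by (simp add: integral_completion)
qed

lemma lebesgue_integrable_lborel_version:
  fixes f :: "'a::euclidean_space \<Rightarrow> real"
  assumes f: "integrable lebesgue f"
  obtains g where "integrable lborel g" "AE x in lborel. f x = g x"
proof -
  obtain g where g: "g \<in> borel_measurable lborel" and ae: "AE x in lborel. f x = g x"
    using completion_ex_borel_measurable_real[of f lborel] f by auto
  have gm: "g \<in> borel_measurable lebesgue" using g by (rule measurable_completion)
  have "integrable lebesgue g"
    by (rule integrable_cong_AE_imp[OF f gm]) (use AE_completion[OF ae] in auto)
  then have "integrable lborel g" using g by (simp add: integrable_completion)
  then show ?thesis using ae that by blast
qed

abbreviation disc_integrable :: "(real \<times> real \<Rightarrow> real) \<Rightarrow> bool" where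
  "disc_integrable f \<equiv> set_integrable lebesgue disc f"

definition disc_inner :: "(real \<times> real \<Rightarrow> real) \<Rightarrow> (real \<times> real \<Rightarrow> real) \<Rightarrow> real" where
  "disc_inner f g = (LINT p:disc|lebesgue. f p * g p)"

definition ridge :: "real \<Rightarrow> real \<times> real \<Rightarrow> real" where
  "ridge \<theta> p = fst p * cos \<theta> + snd p * sin \<theta>"

text \<open>For \<open>\<phi> = \<theta>\<close> the value is just \<open>t\<close>: a ridge
  function in the direction of projection is constant along the integration lines and leaves the
  inner integral in Fubini.\<close>

lemma ridge_rot: "ridge \<phi> (rot \<theta> (t, s)) = t * cos (\<phi> - \<theta>) + s * sin (\<phi> - \<theta>)"
  by (simp add: ridge_def rot_def cos_diff sin_diff algebra_simps)

lemma continuous_on_ridge [continuous_intros]: "continuous_on A (ridge \<theta>)"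
  unfolding ridge_def by (intro continuous_intros)

lemma ridge_measurable [measurable]: "ridge \<theta> \<in> borel \<rightarrow>\<^sub>M borel"
  by (intro borel_measurable_continuous_onI continuous_intros)

lemma set_integrable_disc_mult:
  fixes f g :: "real \<times> real \<Rightarrow> real"
  assumes f: "disc_integrable f" and g: "continuous_on UNIV g"
  shows "disc_integrable (\<lambda>p. f p * g p)"
proof -
  have "(\<lambda>p. g p * f p) absolutely_integrable_on disc"
  proof (rule absolutely_integrable_bounded_measurable_product[OF bilinear_times _ _ _ f])
    show "g \<in> borel_measurable (lebesgue_on disc)"
      using continuous_on_subset[OF g, of disc]
      by (intro continuous_imp_measurable_on_sets_lebesgue) auto
    show "bounded (g ` disc)"
      using compact_continuous_image[OF continuous_on_subset[OF g, of disc] disc_compact]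
      by (simp add: compact_imp_bounded)
  qed simp
  then show ?thesis by (simp add: mult.commute)
qed

lemma set_integrable_disc_continuous:
  fixes g :: "real \<times> real \<Rightarrow> real"
  assumes "continuous_on UNIV g"
  shows "disc_integrable g"
proof -
  have "disc_integrable (\<lambda>_. 1)"
    using lmeasurable_cball[of "0 :: real \<times> real" 1]
    by (simp add: disc_eq_cball set_integrable_def integrable_real_indicator fmeasurable_def)
  then show ?thesis using set_integrable_disc_mult[of "\<lambda>_. 1" g] assms by simp
qed

context
  fixes f :: "real \<times> real \<Rightarrow> real" and h :: "real \<Rightarrow> real"
  assumes f: "disc_integrable f" and h: "continuous_on UNIV h"
begin

text \<open>Replaces \<open>f\<close> on the disc by a Borel function \<open>G\<close>. The two
  agree almost everywhere on almost every line of the given direction, which gives both existence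
  and value of the Radon projection for almost every \<open>t\<close>.\<close>

lemma radon_AE_lborel:
  obtains G where "\<And>p. p \<notin> disc \<Longrightarrow> G p = 0"
    and "disc_inner f (\<lambda>p. h (ridge \<theta> p)) = (LINT p|lborel. G p * h (ridge \<theta> p))"
    and "integrable lborel (\<lambda>p. G p * h (ridge \<theta> p))"
    and "AE t in lborel. t \<in> {-1..1} \<longrightarrow>
      radon_exists \<theta> f t \<and> radon \<theta> f t = (LINT s|lborel. G (rot \<theta> (t, s)))"
proof -
  define F where "F = (\<lambda>p. indicator disc p * f p)"
  have "integrable lebesgue F" using f by (simp add: F_def set_integrable_def)
  then obtain g where g: "integrable lborel g" and Fg: "AE p in lborel. F p = g p"
    by (rule lebesgue_integrable_lborel_version)
  \<comment> \<open>Multiplying by the indicator once more makes \<open>G\<close> vanish everywhere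
    off the disc, not merely almost everywhere.\<close>
  define G where "G = (\<lambda>p. indicator disc p * g p)"
  have G: "integrable lborel G"
    unfolding G_def using integrable_real_mult_indicator[OF _ g, of disc] by (simp add: mult.commute)
  then have [measurable]: "G \<in> borel_measurable borel" by auto
  have FG: "AE p in lborel. F p = G p"
    using Fg by eventually_elim (auto simp: F_def G_def indicator_def split: if_splits)
  have [measurable]: "h \<in> borel_measurable borel" using h by (rule borel_measurable_continuous_onI)
  have hr: "continuous_on UNIV (\<lambda>p. h (ridge \<theta> p))"
    by (rule continuous_on_compose2[OF h]) (auto intro: continuous_intros)
  obtain C where C: "\<And>p. p \<in> disc \<Longrightarrow> \<bar>h (ridge \<theta> p)\<bar> \<le> C"
    using compact_imp_bounded[OF compact_continuous_image[OF continuous_on_subset[OF hr, of disc] disc_compact]]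
    by (auto simp: bounded_real)
  \<comment> \<open>The continuous factor is bounded on the compact disc, and \<open>G\<close> is
    zero elsewhere.\<close>
  have Gh: "integrable lborel (\<lambda>p. G p * h (ridge \<theta> p))"
  proof (rule Bochner_Integration.integrable_bound)
    show "integrable lborel (\<lambda>p. C * G p)" using G by simp
    have "\<bar>G p * h (ridge \<theta> p)\<bar> \<le> \<bar>C * G p\<bar>" for p
    proof (cases "p \<in> disc")
      case True
      then have "\<bar>h (ridge \<theta> p)\<bar> \<le> \<bar>C\<bar>" using C[OF True] by linarith
      then show ?thesis
        using mult_left_mono[of "\<bar>h (ridge \<theta> p)\<bar>" "\<bar>C\<bar>" "\<bar>G p\<bar>"] by (simp add: abs_mult mult.commute)
    qed (simp add: G_def)
    then show "AE p in lborel. norm (G p * h (ridge \<theta> p)) \<le> norm (C * G p)" by simp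
  qed measurable
  have inner: "disc_inner f (\<lambda>p. h (ridge \<theta> p)) = (LINT p|lborel. G p * h (ridge \<theta> p))"
    unfolding disc_inner_def set_lebesgue_integral_def
    by (rule lebesgue_integral_AE_lborel(2)[OF Gh])
       (use FG in eventually_elim, auto simp: F_def)
  have "integrable lborel (\<lambda>p. G (rot \<theta> p))"
    using integrable_distr_eq[of "rot \<theta>" lborel borel G] G by (simp add: lborel_rot)
  then have "AE t in lborel. integrable lborel (\<lambda>s. G (rot \<theta> (t, s)))"
    by (intro lborel_pair.AE_integrable_fst') (simp add: lborel_prod)
  then have "AE t in lborel. t \<in> {-1..1} \<longrightarrow>
      radon_exists \<theta> f t \<and> radon \<theta> f t = (LINT s|lborel. G (rot \<theta> (t, s)))"
    using AE_rot_lines[OF FG]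
  proof eventually_elim
    fix t assume i: "integrable lborel (\<lambda>s. G (rot \<theta> (t, s)))"
      and ae: "AE s in lborel. F (rot \<theta> (t, s)) = G (rot \<theta> (t, s))"
    show "t \<in> {-1..1} \<longrightarrow> radon_exists \<theta> f t \<and> radon \<theta> f t = (LINT s|lborel. G (rot \<theta> (t, s)))"
    proof
      assume t: "t \<in> {-1..1}"
      have "F (rot \<theta> (t, s)) = indicator {- sqrt (1 - t\<^sup>2)..sqrt (1 - t\<^sup>2)} s *\<^sub>R f (t * cos \<theta> - s * sin \<theta>, t * sin \<theta> + s * cos \<theta>)" for s
        using t unfolding F_def by (simp add: disc_rot mem_disc_iff indicator_def) (simp add: rot_def)
      then show "radon_exists \<theta> f t \<and> radon \<theta> f t = (LINT s|lborel. G (rot \<theta> (t, s)))"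
        using lebesgue_integral_AE_lborel[OF i ae]
        unfolding radon_exists_def radon_def set_integrable_def set_lebesgue_integral_def by simp
    qed
  qed
  with Gh inner show ?thesis by (intro that[of G]) (auto simp: G_def)
qed

text \<open>Fubini in the coordinates rotated by \<open>\<theta>\<close>: the factor
  \<open>h (ridge \<theta> p)\<close> becomes \<open>h t\<close>, and the remaining integral over
  \<open>s\<close> is the Radon projection.\<close>

lemma radon_integral:
  shows "set_integrable lebesgue {-1..1} (\<lambda>t. radon \<theta> f t * h t)" (is ?A)
    and "(LINT t:{-1..1}|lebesgue. radon \<theta> f t * h t) = disc_inner f (\<lambda>p. h (ridge \<theta> p))" (is ?B)
proof -
  obtain G where G0: "\<And>p. p \<notin> disc \<Longrightarrow> G p = 0"
    and inner: "disc_inner f (\<lambda>p. h (ridge \<theta> p)) = (LINT p|lborel. G p * h (ridge \<theta> p))"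
    and Gh: "integrable lborel (\<lambda>p. G p * h (ridge \<theta> p))"
    and ae: "AE t in lborel. t \<in> {-1..1} \<longrightarrow>
      radon_exists \<theta> f t \<and> radon \<theta> f t = (LINT s|lborel. G (rot \<theta> (t, s)))"
    using radon_AE_lborel by blast
  have m: "(\<lambda>p. G p * h (ridge \<theta> p)) \<in> borel_measurable borel" using Gh by auto
  define K where "K = (\<lambda>p. G (rot \<theta> p) * h (ridge \<theta> (rot \<theta> p)))"
  have K: "integrable (lborel \<Otimes>\<^sub>M lborel) K"
    using integrable_distr_eq[of "rot \<theta>" lborel borel "\<lambda>p. G p * h (ridge \<theta> p)"] m Gh
    by (simp add: lborel_rot lborel_prod K_def)
  have Kts: "K (t, s) = G (rot \<theta> (t, s)) * h t" for t s by (simp add: K_def ridge_rot)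
  have "(LINT p|lborel. G p * h (ridge \<theta> p)) = integral\<^sup>L (lborel \<Otimes>\<^sub>M lborel) K"
    using integral_distr[of "rot \<theta>" lborel borel "\<lambda>p. G p * h (ridge \<theta> p)"] m
    by (simp add: lborel_rot lborel_prod K_def)
  also have "\<dots> = (LINT t|lborel. LINT s|lborel. K (t, s))"
    using lborel_pair.integral_fst'[OF K] by simp
  finally have iK: "disc_inner f (\<lambda>p. h (ridge \<theta> p)) = (LINT t|lborel. LINT s|lborel. K (t, s))"
    using inner by simp
  have aeK: "AE t in lborel. indicator {-1..1} t *\<^sub>R (radon \<theta> f t * h t) = (LINT s|lborel. K (t, s))"
    using ae
  proof eventually_elim
    case (elim t)
    show ?case
    proof (cases "t \<in> {-1..1}")
      case True
      then show ?thesis using elim by (simp add: Kts)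
    next
      case False
      \<comment> \<open>For \<open>t\<close> outside \<open>{-1..1}\<close> the line misses the
        disc, so both sides vanish.\<close>
      then have "(t, s) \<notin> disc" for s by (simp only: mem_disc_iff) simp
      then have "K (t, s) = 0" for s by (simp add: Kts G0 disc_rot)
      then show ?thesis using False by simp
    qed
  qed
  show ?A ?B
    using lebesgue_integral_AE_lborel[OF lborel_pair.integrable_fst'[OF K] aeK]
    unfolding set_integrable_def set_lebesgue_integral_def iK by simp_all
qed

end

lemma AE_radon_exists:
  assumes "disc_integrable f"
  shows "AE t in lebesgue. t \<in> {-1..1} \<longrightarrow> radon_exists \<theta> f t"
proof -
  obtain G where "AE t in lborel. t \<in> {-1..1} \<longrightarrow>
      radon_exists \<theta> f t \<and> radon \<theta> f t = (LINT s|lborel. G (rot \<theta> (t, s)))"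
    using radon_AE_lborel[OF assms continuous_on_const] by blast
  then have "AE t in lborel. t \<in> {-1..1} \<longrightarrow> radon_exists \<theta> f t" by eventually_elim auto
  then show ?thesis by (rule AE_completion)
qed

text \<open>The disc has finite measure, so \<open>1 + (f p)\<^sup>2\<close> is integrable there,
  and it dominates \<open>\<bar>f p\<bar>\<close>.\<close>

lemma L2_disc_set_integrable:
  assumes "f \<in> L2_disc"
  shows "disc_integrable f"
proof -
  have 1: "disc_integrable (\<lambda>p. 1 + (f p)\<^sup>2)"
    using assms set_integrable_disc_continuous[of "\<lambda>_. 1"]
    by (intro set_integral_add) (auto simp: L2_disc_def)
  show ?thesis
  proof (rule set_integrable_bound[OF 1])
    show "set_borel_measurable lebesgue disc f" using assms by (simp add: L2_disc_def)
    have "\<bar>f p\<bar> \<le> 1 + (f p)\<^sup>2" for p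
      using sum_squares_bound[of "\<bar>f p\<bar>" 1] abs_ge_zero[of "f p"] by simp
    then show "AE p in lebesgue. p \<in> disc \<longrightarrow> norm (f p) \<le> norm (1 + (f p)\<^sup>2)"
      by (simp add: abs_of_nonneg add_nonneg_nonneg)
  qed
qed

subsection \<open>Polynomials on the disc\<close>

lemma disc_inner_commute: "disc_inner f g = disc_inner g f"
  by (simp add: disc_inner_def mult.commute)

lemma disc_inner_scale_right: "disc_inner f (\<lambda>p. c * g p) = c * disc_inner f g"
  using set_integral_mult_right[of lebesgue disc c "\<lambda>p. f p * g p"]
  by (simp add: disc_inner_def algebra_simps)

lemma disc_inner_sum_right:
  assumes "disc_integrable f" "\<And>i. i \<in> I \<Longrightarrow> continuous_on UNIV (g i)"
  shows "disc_inner f (\<lambda>p. \<Sum>i\<in>I. g i p) = (\<Sum>i\<in>I. disc_inner f (g i))"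
proof -
  have "integrable lebesgue (\<lambda>p. indicator disc p *\<^sub>R (f p * g i p))" if "i \<in> I" for i
    using set_integrable_disc_mult[OF assms(1) assms(2)[OF that]] by (simp add: set_integrable_def)
  then show ?thesis
    by (simp add: disc_inner_def set_lebesgue_integral_def sum_distrib_left Bochner_Integration.integral_sum)
qed

lemma disc_inner_diff_left:
  assumes "disc_integrable f" "disc_integrable g" "continuous_on UNIV h"
  shows "disc_inner (\<lambda>p. f p - g p) h = disc_inner f h - disc_inner g h"
  unfolding disc_inner_def left_diff_distrib
  by (rule set_integral_diff(2)[OF set_integrable_disc_mult[OF assms(1,3)] set_integrable_disc_mult[OF assms(2,3)]])

definition monomial :: "nat \<Rightarrow> nat \<Rightarrow> real \<times> real \<Rightarrow> real" where
  "monomial i j p = fst p ^ i * snd p ^ j"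

lemma poly2_iff: "P \<in> poly2 n \<longleftrightarrow> (\<exists>c. P = (\<lambda>p. \<Sum>i\<le>n. \<Sum>j\<le>n - i. c i j * monomial i j p))"
  by (simp add: poly2_def monomial_def case_prod_unfold mult.assoc)

lemma continuous_on_monomial [continuous_intros]: "continuous_on A (monomial i j)"
  unfolding monomial_def by (intro continuous_intros)

lemma continuous_on_poly2: "P \<in> poly2 n \<Longrightarrow> continuous_on A P"
  by (auto simp: poly2_iff intro!: continuous_intros)

lemma disc_integrable_poly2: "P \<in> poly2 n \<Longrightarrow> disc_integrable P"
  by (intro set_integrable_disc_continuous continuous_on_poly2)

lemma poly2_scale:
  assumes "P \<in> poly2 n"
  shows "(\<lambda>p. a * P p) \<in> poly2 n"
proof -
  obtain c where "P = (\<lambda>p. \<Sum>i\<le>n. \<Sum>j\<le>n - i. c i j * monomial i j p)"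
    using assms by (auto simp: poly2_iff)
  then show ?thesis unfolding poly2_iff
    by (intro exI[of _ "\<lambda>i j. a * c i j"]) (simp add: sum_distrib_left mult.assoc)
qed

lemma poly2_add:
  assumes "P \<in> poly2 n" "Q \<in> poly2 n"
  shows "(\<lambda>p. P p + Q p) \<in> poly2 n"
proof -
  obtain c d where "P = (\<lambda>p. \<Sum>i\<le>n. \<Sum>j\<le>n - i. c i j * monomial i j p)"
      "Q = (\<lambda>p. \<Sum>i\<le>n. \<Sum>j\<le>n - i. d i j * monomial i j p)"
    using assms by (auto simp: poly2_iff)
  then show ?thesis unfolding poly2_iff
    by (intro exI[of _ "\<lambda>i j. c i j + d i j"]) (simp add: sum.distrib distrib_right)
qed

lemma poly2_zero: "(\<lambda>_. 0) \<in> poly2 n"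
  unfolding poly2_iff by (intro exI[of _ "\<lambda>_ _. 0"]) simp

lemma poly2_sum: "(\<And>i. i \<in> I \<Longrightarrow> P i \<in> poly2 n) \<Longrightarrow> (\<lambda>p. \<Sum>i\<in>I. P i p) \<in> poly2 n"
  by (induction I rule: infinite_finite_induct) (auto intro: poly2_add poly2_zero)

lemma poly2_diff:
  assumes "P \<in> poly2 n" "Q \<in> poly2 n"
  shows "(\<lambda>p. P p - Q p) \<in> poly2 n"
  using poly2_add[OF assms(1) poly2_scale[OF assms(2), of "-1"]]
  by (simp only: mult_minus1 diff_conv_add_uminus)

lemma poly2_monomial:
  assumes "i + j \<le> n"
  shows "monomial i j \<in> poly2 n"
  unfolding poly2_iff
proof (intro exI ext)
  fix p
  have "(\<Sum>i'\<le>n. \<Sum>j'\<le>n - i'. (if i' = i \<and> j' = j then 1 else 0) * monomial i' j' p)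
      = (\<Sum>i'\<le>n. if i' = i then \<Sum>j'\<le>n - i. if j' = j then monomial i j p else 0 else 0)"
    by (intro sum.cong refl) (simp add: if_distrib[of "\<lambda>x. x * _"] cong: if_cong)
  also have "\<dots> = monomial i j p" using assms by (simp add: sum.delta)
  finally show "monomial i j p = (\<Sum>i'\<le>n. \<Sum>j'\<le>n - i'. (if i' = i \<and> j' = j then 1 else 0) * monomial i' j' p)" ..
qed

lemma disc_inner_poly2_eq_0:
  assumes "disc_integrable f" "P \<in> poly2 n" "\<And>i j. i + j \<le> n \<Longrightarrow> disc_inner f (monomial i j) = 0"
  shows "disc_inner f P = 0"
proof -
  obtain c where P: "P = (\<lambda>p. \<Sum>i\<le>n. \<Sum>j\<le>n - i. c i j * monomial i j p)"
    using assms by (auto simp: poly2_iff)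
  have "disc_inner f P = (\<Sum>i\<le>n. disc_inner f (\<lambda>p. \<Sum>j\<le>n - i. c i j * monomial i j p))"
    unfolding P by (intro disc_inner_sum_right assms(1) continuous_intros)
  also have "\<dots> = (\<Sum>i\<le>n. \<Sum>j\<le>n - i. disc_inner f (\<lambda>p. c i j * monomial i j p))"
    by (intro sum.cong refl disc_inner_sum_right assms(1) continuous_intros)
  also have "\<dots> = 0"
    by (intro sum.neutral ballI) (simp add: disc_inner_scale_right assms(3))
  finally show ?thesis .
qed

lemma ridge_power:
  "ridge \<theta> p ^ n = (\<Sum>i\<le>n. of_nat (n choose i) * cos \<theta> ^ i * sin \<theta> ^ (n - i) * monomial i (n - i) p)"
  unfolding ridge_def binomial_ring monomial_def
  by (intro sum.cong refl) (simp add: power_mult_distrib algebra_simps)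

lemma ridge_power_poly2: "n \<le> k \<Longrightarrow> (\<lambda>p. ridge \<theta> p ^ n) \<in> poly2 k"
  unfolding ridge_power by (intro poly2_sum poly2_scale poly2_monomial) auto

lemma ridge_U_eq: "ridge_U k \<theta> = (\<lambda>p. U k (ridge \<theta> p))"
  by (auto simp: ridge_U_def ridge_def)

lemma ridge_U_expand: "ridge_U k \<theta> = (\<lambda>p. \<Sum>i\<le>k. coeff (cheb_U k) i * ridge \<theta> p ^ i)"
  by (simp add: ridge_U_eq poly_altdef degree_cheb_U)

lemma ridge_U_poly2: "ridge_U k \<theta> \<in> poly2 k"
  unfolding ridge_U_expand by (intro poly2_sum poly2_scale ridge_power_poly2) auto

text \<open>Dividing by \<open>cos \<theta> ^ n\<close> turns the hypothesis into the vanishing of a polynomial in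
  \<open>tan \<theta>\<close>.\<close>

lemma trig_form_eq_0:
  fixes M :: "nat \<Rightarrow> real"
  assumes "\<And>\<theta>. (\<Sum>i\<le>n. of_nat (n choose i) * cos \<theta> ^ i * sin \<theta> ^ (n - i) * M i) = 0" and "i \<le> n"
  shows "M i = 0"
proof -
  define q where "q = (\<Sum>i\<le>n. monom (of_nat (n choose i) * M i) (n - i))"
  have "poly q x = 0" for x
  proof -
    let ?\<theta> = "arctan x"
    have c: "cos ?\<theta> \<noteq> 0" using cos_arctan_not_zero by blast
    have s: "sin ?\<theta> = x * cos ?\<theta>" by (simp add: sin_arctan cos_arctan)
    have "cos ?\<theta> ^ n * poly q x = (\<Sum>i\<le>n. cos ?\<theta> ^ n * (of_nat (n choose i) * M i * x ^ (n - i)))"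
      by (simp add: q_def poly_sum poly_monom sum_distrib_left)
    also have "\<dots> = (\<Sum>i\<le>n. of_nat (n choose i) * cos ?\<theta> ^ i * sin ?\<theta> ^ (n - i) * M i)"
    proof (intro sum.cong refl)
      fix i assume "i \<in> {..n}"
      then have "cos ?\<theta> ^ n = cos ?\<theta> ^ i * cos ?\<theta> ^ (n - i)" by (simp add: power_add[symmetric])
      then show "cos ?\<theta> ^ n * (of_nat (n choose i) * M i * x ^ (n - i))
          = of_nat (n choose i) * cos ?\<theta> ^ i * sin ?\<theta> ^ (n - i) * M i"
        by (simp add: s power_mult_distrib mult_ac)
    qed
    also have "\<dots> = 0" by (rule assms(1))
    finally have "cos ?\<theta> ^ n * poly q x = 0" .
    then show ?thesis using c by simp
  qed
  then have q: "q = 0" by (simp add: poly_all_0_iff_0[symmetric])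
  have "coeff q (n - i) = (\<Sum>j\<le>n. if j = i then of_nat (n choose j) * M j else 0)"
    unfolding q_def coeff_sum coeff_monom using assms(2) by (intro sum.cong refl) auto
  then have "of_nat (n choose i) * M i = 0" using assms(2) q by simp
  then show ?thesis using assms(2) by simp
qed

text \<open>By the binomial theorem the inner product with \<open>ridge \<theta> p ^ n\<close> is a
  trigonometric form in \<open>\<theta>\<close> whose coefficients are binomial multiples of the
  monomial moments. This is the dual form of the fact that ridge powers span the homogeneous
  polynomials of degree \<open>n\<close>.\<close>

lemma disc_inner_monomial_eq_0:
  assumes "disc_integrable f" "\<And>\<theta>. disc_inner f (\<lambda>p. ridge \<theta> p ^ n) = 0" "i + j = n"
  shows "disc_inner f (monomial i j) = 0"
proof -
  have "(\<Sum>i\<le>n. of_nat (n choose i) * cos \<theta> ^ i * sin \<theta> ^ (n - i) * disc_inner f (monomial i (n - i))) = 0" for \<theta>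
  proof -
    have "disc_inner f (\<lambda>p. ridge \<theta> p ^ n)
        = (\<Sum>i\<le>n. disc_inner f (\<lambda>p. of_nat (n choose i) * cos \<theta> ^ i * sin \<theta> ^ (n - i) * monomial i (n - i) p))"
      unfolding ridge_power by (intro disc_inner_sum_right assms(1) continuous_intros)
    then show ?thesis using assms(2) by (simp add: disc_inner_scale_right)
  qed
  then have "disc_inner f (monomial i (n - i)) = 0"
    by (rule trig_form_eq_0[where M = "\<lambda>i. disc_inner f (monomial i (n - i))"]) (use assms(3) in simp)
  then show ?thesis using assms(3) by auto
qed

lemma disc_inner_eq_0_of_ridge:
  assumes "disc_integrable f" "\<And>m \<theta>. m \<le> n \<Longrightarrow> disc_inner f (\<lambda>p. ridge \<theta> p ^ m) = 0" "P \<in> poly2 n"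
  shows "disc_inner f P = 0"
  using assms(1,3)
proof (rule disc_inner_poly2_eq_0)
  fix i j assume "i + j \<le> n"
  then show "disc_inner f (monomial i j) = 0"
    by (rule disc_inner_monomial_eq_0[OF assms(1) assms(2) refl])
qed

text \<open>The square of \<open>P\<close> vanishes almost everywhere on the disc, hence by
  continuity \<open>P\<close> vanishes on the open ball; restricting to lines through the origin
  propagates this to the whole plane. Elements of \<open>poly2\<close> are functions on the plane,
  so this last step is what yields equality.\<close>

lemma poly2_definite:
  assumes P: "P \<in> poly2 n" and 0: "disc_inner P P = 0"
  shows "P = (\<lambda>_. 0)"
proof -
  have cont: "continuous_on UNIV P" using P by (rule continuous_on_poly2)
  have "integrable lebesgue (\<lambda>p. indicator disc p *\<^sub>R (P p * P p))"
    using set_integrable_disc_mult[OF disc_integrable_poly2[OF P] cont] by (simp add: set_integrable_def)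
  then have "AE p in lebesgue. indicator disc p *\<^sub>R (P p * P p) = 0"
    using 0 unfolding disc_inner_def set_lebesgue_integral_def
    by (subst (asm) integral_nonneg_eq_0_iff_AE) auto
  then have "negligible {p. indicator disc p *\<^sub>R (P p * P p) \<noteq> 0}"
    unfolding eventually_ae_filter_negligible by (auto intro: negligible_subset)
  then have "negligible (ball 0 1 \<inter> {p. P p \<noteq> 0})"
    by (rule negligible_subset) (auto simp: disc_eq_cball)
  moreover have "open (ball 0 1 \<inter> {p. P p \<noteq> 0})"
    using cont by (intro open_Int open_ball open_Collect_neq) auto
  ultimately have "ball 0 1 \<inter> {p. P p \<noteq> 0} = {}" using open_not_negligible by blast
  then have ball: "P p = 0" if "norm p < 1" for p using that by auto
  obtain c where c: "P = (\<lambda>p. \<Sum>i\<le>n. \<Sum>j\<le>n - i. c i j * monomial i j p)"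
    using P by (auto simp: poly2_iff)
  show ?thesis
  proof
    fix p :: "real \<times> real"
    define q where "q = (\<Sum>i\<le>n. \<Sum>j\<le>n - i. monom (c i j * monomial i j p) (i + j))"
    have q: "poly q t = P (t *\<^sub>R p)" for t
      by (simp add: q_def c poly_sum poly_monom monomial_def power_mult_distrib power_add mult_ac)
    \<comment> \<open>For these \<open>t\<close> the point \<open>t *\<^sub>R p\<close> lies in the
      open unit ball. Adding 1 to the norm keeps the bound meaningful at
      \<open>p = 0\<close>.\<close>
    have "{0<..<1 / (1 + norm p)} \<subseteq> {t. poly q t = 0}"
    proof
      fix t assume t: "t \<in> {0<..<1 / (1 + norm p)}"
      then have "t * (1 + norm p) < 1" using pos_less_divide_eq[of "1 + norm p" t 1]
        by (simp add: add_pos_nonneg)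
      then have "norm (t *\<^sub>R p) < 1" using t by (simp add: distrib_left)
      then show "t \<in> {t. poly q t = 0}" by (simp add: q ball)
    qed
    then have "infinite {t. poly q t = 0}"
      using infinite_Ioo[of 0 "1 / (1 + norm p)"] finite_subset by (metis add_pos_nonneg divide_pos_pos norm_ge_zero zero_less_one)
    then have "q = 0" using poly_roots_finite by blast
    then show "P p = 0" using q[of 1] by simp
  qed
qed

section \<open>Orthogonality and totality of the ridge polynomials\<close>

lemma radon_ridge_U:
  assumes "t \<in> {-1..1}"
  shows "radon \<theta> (ridge_U k \<phi>) t = 2 / real (k + 1) * U k (cos (\<phi> - \<theta>)) * (U k t * sqrt (1 - t\<^sup>2))"
proof -
  have "ridge \<phi> (t * cos \<theta> - s * sin \<theta>, t * sin \<theta> + s * cos \<theta>) = t * cos (\<phi> - \<theta>) + s * sin (\<phi> - \<theta>)" for s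
    using ridge_rot[of \<phi> \<theta> t s] by (simp add: rot_def)
  then show ?thesis
    using integral_U_chord[OF assms, of k "\<phi> - \<theta>"] unfolding radon_def ridge_U_eq by (simp only: mult_ac)
qed

text \<open>The chord formula makes the Radon projection of \<open>ridge_U k \<phi>\<close> a
  multiple of \<open>U k t * sqrt (1 - t\<^sup>2)\<close>, so the inner product over the disc
  reduces to a one-dimensional moment.\<close>

lemma disc_inner_ridge_U_power:
  assumes "n \<le> k"
  shows "disc_inner (ridge_U k \<phi>) (\<lambda>p. ridge \<theta> p ^ n)
     = (if n = k then 2 / real (k + 1) * U k (cos (\<phi> - \<theta>)) * (pi / 2 ^ (k + 1)) else 0)"
proof -
  have "disc_inner (ridge_U k \<phi>) (\<lambda>p. ridge \<theta> p ^ n) = (LINT t:{-1..1}|lebesgue. radon \<theta> (ridge_U k \<phi>) t * t ^ n)"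
    by (rule radon_integral(2)[symmetric, OF disc_integrable_poly2[OF ridge_U_poly2]]) (intro continuous_intros)
  also have "\<dots> = (LINT t:{-1..1}|lebesgue. 2 / real (k + 1) * U k (cos (\<phi> - \<theta>)) * (t ^ n * U k t * sqrt (1 - t\<^sup>2)))"
    by (intro set_lebesgue_integral_cong) (auto simp: radon_ridge_U mult_ac)
  also have "\<dots> = 2 / real (k + 1) * U k (cos (\<phi> - \<theta>)) * (LINT t:{-1..1}|lebesgue. t ^ n * U k t * sqrt (1 - t\<^sup>2))"
    by (rule set_integral_mult_right)
  finally show ?thesis using integral_U_power_sqrt[OF assms] by simp
qed

text \<open>A polynomial of degree below \<open>k\<close> satisfying the orthogonality condition is
  orthogonal to itself, hence zero. The exact-degree clause of \<open>orth_poly2\<close> therefore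
  collapses to membership in \<open>poly2 k\<close>, which makes closure under differences
  evident.\<close>

lemma orth_poly2_iff:
  "P \<in> orth_poly2 k \<longleftrightarrow> P \<in> poly2 k \<and> (\<forall>j<k. \<forall>Q \<in> poly2 j. disc_inner P Q = 0)"
proof -
  have "P = (\<lambda>_. 0)" if "P \<in> poly2 j" "j < k" "\<forall>j<k. \<forall>Q \<in> poly2 j. disc_inner P Q = 0" for j
    using that poly2_definite by blast
  then show ?thesis
    unfolding orth_poly2_def disc_inner_def[symmetric] using poly2_zero[of k] by blast
qed

lemma ridge_U_orth: "ridge_U k \<phi> \<in> orth_poly2 k"
  unfolding orth_poly2_iff
proof (intro conjI allI impI ballI ridge_U_poly2)
  fix j Q assume "j < k" and Q: "Q \<in> poly2 j"
  then show "disc_inner (ridge_U k \<phi>) Q = 0"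
    by (intro disc_inner_eq_0_of_ridge[OF disc_integrable_poly2[OF ridge_U_poly2] _ Q])
       (simp add: disc_inner_ridge_U_power)
qed

lemma orth_poly2_ridge_power: "D \<in> orth_poly2 k \<Longrightarrow> n < k \<Longrightarrow> disc_inner D (\<lambda>p. ridge \<theta> p ^ n) = 0"
  using ridge_power_poly2[OF order_refl, of \<theta> n] by (simp add: orth_poly2_iff)

text \<open>Orthogonality removes every power below \<open>k\<close>, leaving the leading
  coefficient \<open>2 ^ k\<close>.\<close>

lemma disc_inner_ridge_U:
  assumes "D \<in> orth_poly2 k"
  shows "disc_inner D (ridge_U k \<theta>) = 2 ^ k * disc_inner D (\<lambda>p. ridge \<theta> p ^ k)"
proof -
  have D: "disc_integrable D" using assms by (auto simp: orth_poly2_iff intro: disc_integrable_poly2)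
  have "disc_inner D (ridge_U k \<theta>) = (\<Sum>i\<le>k. disc_inner D (\<lambda>p. coeff (cheb_U k) i * ridge \<theta> p ^ i))"
    unfolding ridge_U_expand by (intro disc_inner_sum_right D continuous_intros)
  also have "\<dots> = (\<Sum>i\<le>k. coeff (cheb_U k) i * disc_inner D (\<lambda>p. ridge \<theta> p ^ i))"
    by (simp add: disc_inner_scale_right)
  also have "\<dots> = (\<Sum>i\<le>k. if i = k then coeff (cheb_U k) k * disc_inner D (\<lambda>p. ridge \<theta> p ^ k) else 0)"
    using orth_poly2_ridge_power[OF assms] by (intro sum.cong refl) auto
  finally show ?thesis by (simp add: lead_coeff_cheb_U)
qed

lemma disc_inner_ridge_U_ridge_U:
  "disc_inner (ridge_U k \<phi>) (ridge_U k \<theta>) = pi / real (k + 1) * U k (cos (\<theta> - \<phi>))"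
  using cos_minus[of "\<theta> - \<phi>"]
  by (simp add: disc_inner_ridge_U[OF ridge_U_orth] disc_inner_ridge_U_power)

text \<open>Being orthogonal to the ridge polynomials of degree \<open>k\<close> means being
  orthogonal to the \<open>k\<close>-th ridge powers; lower powers are covered by
  \<open>orth_poly2\<close>. Together they force \<open>D\<close> to be orthogonal to
  itself.\<close>

lemma orth_poly2_total:
  assumes D: "D \<in> orth_poly2 k" and 0: "\<And>\<theta>. disc_inner D (ridge_U k \<theta>) = 0"
  shows "D = (\<lambda>_. 0)"
proof -
  have Dk: "D \<in> poly2 k" using D by (simp add: orth_poly2_iff)
  have "disc_inner D (\<lambda>p. ridge \<theta> p ^ m) = 0" if "m \<le> k" for m \<theta>
  proof (cases "m = k")
    case True
    then show ?thesis using disc_inner_ridge_U[OF D, of \<theta>] 0 by simp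
  next
    case False
    then show ?thesis using that by (intro orth_poly2_ridge_power[OF D]) simp
  qed
  then have "disc_inner D D = 0"
    by (rule disc_inner_eq_0_of_ridge[OF disc_integrable_poly2[OF Dk] _ Dk])
  then show ?thesis by (rule poly2_definite[OF Dk])
qed

subsection \<open>Quadrature and projections\<close>

text \<open>The number of nodes is odd, so doubling the frequency does not alias: the quadrature is exact
  for all even frequencies up to \<open>4 * m\<close>.\<close>

lemma sum_cis_node:
  assumes "j \<le> 2 * m" "l \<le> 2 * m"
  shows "(\<Sum>\<nu>\<le>2 * m. cis (2 * (real j - real l) * node m \<nu>)) = (if j = l then of_nat (2 * m + 1) else 0)"
proof (cases "j = l")
  case False
  define N where "N = 2 * m + 1"
  define \<alpha> where "\<alpha> = 2 * (real j - real l) * (2 * pi / real N)"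
  have N0: "real N \<noteq> 0" by (simp add: N_def)
  have "cis \<alpha> \<noteq> 1"
  proof
    assume "cis \<alpha> = 1"
    then have "cos \<alpha> = 1" by (simp add: complex_eq_iff)
    then obtain n :: int where n: "\<alpha> = of_int n * 2 * pi" by (auto simp: cos_one_2pi_int)
    then have "2 * pi * (2 * (real j - real l)) = 2 * pi * (of_int n * real N)"
      using N0 by (simp add: \<alpha>_def field_simps)
    then have "2 * (real j - real l) = of_int n * real N" by (subst (asm) mult_cancel_left) simp
    then have "real_of_int (2 * (int j - int l)) = real_of_int (n * int N)" by simp
    then have eq: "2 * (int j - int l) = n * int N" by (simp only: of_int_eq_iff)
    \<comment> \<open>Oddness of \<open>N\<close> cancels the factor 2; then \<open>N\<close>
      divides \<open>j - l\<close>, whose absolute value is at most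
      \<open>2 * m < N\<close>.\<close>
    have "coprime (int N) 2" by (simp add: N_def)
    moreover have "int N dvd 2 * (int j - int l)" using eq by simp
    ultimately have "int N dvd int j - int l" by (simp only: coprime_dvd_mult_right_iff)
    moreover have "\<bar>int j - int l\<bar> < int N" using assms by (simp add: N_def)
    ultimately have "int j - int l = 0" 
      using dvd_imp_le_int[of "int j - int l" "int N"] by (cases "int j - int l = 0") auto
    then show False using False by simp
  qed
  moreover have "cis \<alpha> ^ N = 1"
  proof -
    have "real N * \<alpha> = 2 * pi * of_int (2 * (int j - int l))" using N0 by (simp add: \<alpha>_def)
    then show ?thesis unfolding Complex.DeMoivre by (simp only: cis_multiple_2pi Ints_of_int)
  qed
  ultimately have "(\<Sum>\<nu><N. cis \<alpha> ^ \<nu>) = 0" by (simp add: geometric_sum)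
  moreover have "cis (2 * (real j - real l) * node m \<nu>) = cis \<alpha> ^ \<nu>" for \<nu>
    unfolding Complex.DeMoivre by (rule arg_cong[where f = cis]) (simp add: \<alpha>_def node_def N_def)
  moreover have "{..2 * m} = {..<N}" by (auto simp: N_def)
  ultimately show ?thesis using False by simp
qed simp

text \<open>As a function of the angle, \<open>ridge \<phi> p ^ k\<close> has only the frequencies
  \<open>-k, -k + 2, ..., k\<close>, and \<open>U k (cos (\<theta> - \<phi>))\<close> is the
  reproducing kernel for exactly these. The products have frequencies \<open>2 * (j - l)\<close>,
  for which the node sum is exact.\<close>

lemma ridge_power_quadrature:
  assumes k: "k \<le> 2 * m"
  shows "(\<Sum>\<nu>\<le>2 * m. U k (cos (\<theta> - node m \<nu>)) * ridge (node m \<nu>) p ^ k) = real (2 * m + 1) * ridge \<theta> p ^ k"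
proof -
  \<comment> \<open>With \<open>z = x - i * y\<close>, the ridge form is the real part of
    \<open>z * cis \<phi>\<close>; \<open>a\<close> and \<open>b\<close> are the halves of
    \<open>z\<close> and of its conjugate.\<close>
  define a where "a = Complex (fst p / 2) (- snd p / 2)"
  define b where "b = Complex (fst p / 2) (snd p / 2)"
  define w where "w = (\<lambda>j. of_nat (k choose j) * a ^ j * b ^ (k - j))"
  have pow: "complex_of_real (ridge \<phi> p ^ k) = (\<Sum>j\<le>k. w j * cis ((2 * real j - real k) * \<phi>))" for \<phi>
  proof -
    have "complex_of_real (ridge \<phi> p) = a * cis \<phi> + b * cis (- \<phi>)"
      by (simp add: ridge_def a_def b_def complex_eq_iff)
    then have "complex_of_real (ridge \<phi> p ^ k)
        = (\<Sum>j\<le>k. of_nat (k choose j) * (a * cis \<phi>) ^ j * (b * cis (- \<phi>)) ^ (k - j))"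
      by (simp add: binomial_ring)
    also have "\<dots> = (\<Sum>j\<le>k. w j * cis ((2 * real j - real k) * \<phi>))"
    proof (intro sum.cong refl)
      fix j assume j: "j \<in> {..k}"
      have "cis \<phi> ^ j * cis (- \<phi>) ^ (k - j) = cis ((2 * real j - real k) * \<phi>)"
      proof -
        have "cis \<phi> ^ j * cis (- \<phi>) ^ (k - j) = cis (real j * \<phi> + real (k - j) * - \<phi>)"
          by (simp only: Complex.DeMoivre cis_mult)
        moreover have "real j * \<phi> + real (k - j) * - \<phi> = (2 * real j - real k) * \<phi>"
          using j by (simp add: of_nat_diff algebra_simps)
        ultimately show ?thesis by simp
      qed
      then show "of_nat (k choose j) * (a * cis \<phi>) ^ j * (b * cis (- \<phi>)) ^ (k - j) = w j * cis ((2 * real j - real k) * \<phi>)"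
        by (simp add: w_def power_mult_distrib mult_ac)
    qed
    finally show ?thesis .
  qed
  have "complex_of_real (\<Sum>\<nu>\<le>2 * m. U k (cos (\<theta> - node m \<nu>)) * ridge (node m \<nu>) p ^ k)
      = (\<Sum>\<nu>\<le>2 * m. \<Sum>l\<le>k. \<Sum>j\<le>k. cis ((2 * real l - real k) * (\<theta> - node m \<nu>)) * (w j * cis ((2 * real j - real k) * node m \<nu>)))"
    by (simp only: of_real_sum of_real_mult U_cos_cis pow sum_product)
  also have "\<dots> = (\<Sum>\<nu>\<le>2 * m. \<Sum>l\<le>k. \<Sum>j\<le>k. w j * cis ((2 * real l - real k) * \<theta>) * cis (2 * (real j - real l) * node m \<nu>))"
  proof (intro sum.cong refl)
    fix \<nu> l j
    have "cis ((2 * real l - real k) * (\<theta> - node m \<nu>)) * cis ((2 * real j - real k) * node m \<nu>)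
      = cis ((2 * real l - real k) * \<theta>) * cis (2 * (real j - real l) * node m \<nu>)"
      unfolding cis_mult by (rule arg_cong[where f = cis]) (simp add: algebra_simps)
    then show "cis ((2 * real l - real k) * (\<theta> - node m \<nu>)) * (w j * cis ((2 * real j - real k) * node m \<nu>))
      = w j * cis ((2 * real l - real k) * \<theta>) * cis (2 * (real j - real l) * node m \<nu>)"
      by (simp add: mult_ac)
  qed
  also have "\<dots> = (\<Sum>l\<le>k. \<Sum>j\<le>k. \<Sum>\<nu>\<le>2 * m. w j * cis ((2 * real l - real k) * \<theta>) * cis (2 * (real j - real l) * node m \<nu>))"
    by (subst sum.swap) (intro sum.cong refl sum.swap)
  also have "\<dots> = (\<Sum>l\<le>k. \<Sum>j\<le>k. if j = l then w j * cis ((2 * real l - real k) * \<theta>) * of_nat (2 * m + 1) else 0)"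
  proof (intro sum.cong refl)
    fix l j assume "l \<in> {..k}" "j \<in> {..k}"
    then have "l \<le> 2 * m" "j \<le> 2 * m" using k by auto
    then show "(\<Sum>\<nu>\<le>2 * m. w j * cis ((2 * real l - real k) * \<theta>) * cis (2 * (real j - real l) * node m \<nu>))
        = (if j = l then w j * cis ((2 * real l - real k) * \<theta>) * of_nat (2 * m + 1) else 0)"
      unfolding sum_distrib_left[symmetric] by (simp only: sum_cis_node split: if_split) simp
  qed
  also have "\<dots> = (\<Sum>l\<le>k. w l * cis ((2 * real l - real k) * \<theta>)) * of_nat (2 * m + 1)"
    unfolding sum_distrib_right by (intro sum.cong refl) (simp add: sum.delta del: of_nat_add of_nat_Suc)
  also have "\<dots> = complex_of_real (real (2 * m + 1) * ridge \<theta> p ^ k)"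
    unfolding pow[symmetric] by simp
  finally show ?thesis by (simp only: of_real_eq_iff)
qed

section \<open>The orthogonal projection expressed through the nodes\<close>

definition node_weight :: "nat \<Rightarrow> nat \<Rightarrow> real" where
  "node_weight m k = real (k + 1) / (pi * real (2 * m + 1))"

text \<open>The candidate for \<open>proj k f\<close>. Its weight averages over the
  \<open>2 * m + 1\<close> nodes and inverts the factor \<open>pi / (k + 1)\<close> in the inner
  products of ridge polynomials.\<close>

definition node_proj :: "nat \<Rightarrow> nat \<Rightarrow> (real \<times> real \<Rightarrow> real) \<Rightarrow> real \<times> real \<Rightarrow> real" where
  "node_proj m k f p = (\<Sum>\<nu>\<le>2 * m. node_weight m k *
     disc_inner f (ridge_U k (node m \<nu>)) * ridge_U k (node m \<nu>) p)"

lemma continuous_on_ridge_U [continuous_intros]: "continuous_on A (ridge_U k \<theta>)"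
  by (rule continuous_on_poly2[OF ridge_U_poly2])

lemma node_proj_poly2: "node_proj m k f \<in> poly2 k"
  unfolding node_proj_def[abs_def] by (intro poly2_sum poly2_scale ridge_U_poly2)

lemma disc_inner_node_proj:
  assumes "disc_integrable Q"
  shows "disc_inner (node_proj m k f) Q = (\<Sum>\<nu>\<le>2 * m. node_weight m k *
     disc_inner f (ridge_U k (node m \<nu>)) * disc_inner (ridge_U k (node m \<nu>)) Q)"
proof -
  have "disc_inner Q (node_proj m k f) = (\<Sum>\<nu>\<le>2 * m. disc_inner Q (\<lambda>p. node_weight m k *
     disc_inner f (ridge_U k (node m \<nu>)) * ridge_U k (node m \<nu>) p))"
    unfolding node_proj_def[abs_def] by (intro disc_inner_sum_right assms continuous_intros)
  then show ?thesis by (simp add: disc_inner_scale_right disc_inner_commute[of Q])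
qed

lemma node_proj_orth: "node_proj m k f \<in> orth_poly2 k"
  unfolding orth_poly2_iff
proof (intro conjI allI impI ballI node_proj_poly2)
  fix j Q assume "j < k" "Q \<in> poly2 j"
  then show "disc_inner (node_proj m k f) Q = 0"
    using ridge_U_orth[of k] by (simp add: disc_inner_node_proj disc_integrable_poly2 orth_poly2_iff)
qed

lemma orth_poly2_diff:
  assumes "P \<in> orth_poly2 k" "Q \<in> orth_poly2 k"
  shows "(\<lambda>p. P p - Q p) \<in> orth_poly2 k"
  using assms unfolding orth_poly2_iff
  by (auto simp: poly2_diff disc_inner_diff_left disc_integrable_poly2 continuous_on_poly2)

text \<open>By totality it suffices to compare inner products with every
  \<open>ridge_U k \<theta>\<close>; moving the node sum inside the inner product lets the
  quadrature formula act pointwise.\<close>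

lemma node_proj_self:
  assumes k: "k \<le> 2 * m" and P: "P \<in> orth_poly2 k"
  shows "node_proj m k P = P"
proof -
  have Pk: "P \<in> poly2 k" using P by (simp add: orth_poly2_iff)
  have "disc_inner (\<lambda>p. P p - node_proj m k P p) (ridge_U k \<theta>) = 0" for \<theta>
  proof -
    \<comment> \<open>The weight cancels \<open>pi / (k + 1)\<close>, and \<open>2 ^ k\<close> comes
      from replacing \<open>ridge_U\<close> by its leading power against \<open>P\<close>.\<close>
    have "disc_inner (node_proj m k P) (ridge_U k \<theta>)
      = (\<Sum>\<nu>\<le>2 * m. 2 ^ k / real (2 * m + 1) * (U k (cos (\<theta> - node m \<nu>)) * disc_inner P (\<lambda>p. ridge (node m \<nu>) p ^ k)))"
      unfolding disc_inner_node_proj[OF disc_integrable_poly2[OF ridge_U_poly2]]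
        disc_inner_ridge_U_ridge_U disc_inner_ridge_U[OF P]
      by (intro sum.cong refl) (simp add: node_weight_def del: of_nat_Suc of_nat_add)
    also have "\<dots> = 2 ^ k / real (2 * m + 1) *
        disc_inner P (\<lambda>p. \<Sum>\<nu>\<le>2 * m. U k (cos (\<theta> - node m \<nu>)) * ridge (node m \<nu>) p ^ k)"
      by (subst disc_inner_sum_right[OF disc_integrable_poly2[OF Pk]])
         (auto simp: disc_inner_scale_right sum_distrib_left intro!: continuous_intros)
    also have "\<dots> = 2 ^ k * disc_inner P (\<lambda>p. ridge \<theta> p ^ k)"
      unfolding ridge_power_quadrature[OF k] disc_inner_scale_right by simp
    also have "\<dots> = disc_inner P (ridge_U k \<theta>)" by (rule disc_inner_ridge_U[OF P, symmetric])
    finally show ?thesis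
      by (simp add: disc_inner_diff_left disc_integrable_poly2[OF Pk] disc_integrable_poly2[OF node_proj_poly2]
          continuous_on_ridge_U)
  qed
  then have "(\<lambda>p. P p - node_proj m k P p) = (\<lambda>_. 0)"
    by (rule orth_poly2_total[OF orth_poly2_diff[OF P node_proj_orth]])
  then show ?thesis by (auto simp: fun_eq_iff)
qed

text \<open>The operator \<open>node_proj m k\<close> is symmetric for \<open>disc_inner\<close> and
  fixes \<open>Q\<close>, so it can be moved from \<open>f\<close> to \<open>Q\<close> and
  dropped.\<close>

lemma disc_inner_node_proj_self:
  assumes f: "disc_integrable f" and k: "k \<le> 2 * m" and Q: "Q \<in> orth_poly2 k"
  shows "disc_inner (node_proj m k f) Q = disc_inner f Q"
proof -
  have Qi: "disc_integrable Q" using Q by (auto simp: orth_poly2_iff intro: disc_integrable_poly2)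
  have "disc_inner f (node_proj m k Q) = (\<Sum>\<nu>\<le>2 * m. disc_inner f (\<lambda>p. node_weight m k *
     disc_inner Q (ridge_U k (node m \<nu>)) * ridge_U k (node m \<nu>) p))"
    unfolding node_proj_def[abs_def] by (intro disc_inner_sum_right f continuous_intros)
  then have "disc_inner f (node_proj m k Q) = disc_inner (node_proj m k f) Q"
    unfolding disc_inner_node_proj[OF Qi] disc_inner_scale_right by (simp add: disc_inner_commute[of Q] mult_ac)
  then show ?thesis using node_proj_self[OF k Q] by simp
qed

text \<open>Shows that the definite description in \<open>proj\<close> has a unique witness:
  \<open>node_proj\<close> satisfies the conditions, and the difference of two solutions lies in
  \<open>orth_poly2 k\<close> and is orthogonal to itself.\<close>

lemma proj_eq_node_proj:
  assumes f: "disc_integrable f" and k: "k \<le> 2 * m"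
  shows "proj k f = node_proj m k f"
  unfolding proj_def
proof (rule the_equality)
  have cont: "continuous_on UNIV Q" if "Q \<in> orth_poly2 k" for Q
    using that by (auto simp: orth_poly2_iff intro: continuous_on_poly2)
  have di: "(LINT p:disc|lebesgue. (f p - P p) * Q p) = disc_inner f Q - disc_inner P Q"
    if "P \<in> orth_poly2 k" "Q \<in> orth_poly2 k" for P Q
    using disc_inner_diff_left[OF f _ cont[OF that(2)], of P] that(1)
    by (auto simp: disc_inner_def orth_poly2_iff disc_integrable_poly2)
  show "node_proj m k f \<in> orth_poly2 k \<and>
      (\<forall>Q\<in>orth_poly2 k. (LINT p:disc|lebesgue. (f p - node_proj m k f p) * Q p) = 0)"
    by (simp add: node_proj_orth di disc_inner_node_proj_self[OF f k])
  fix P assume P: "P \<in> orth_poly2 k \<and> (\<forall>Q\<in>orth_poly2 k. (LINT p:disc|lebesgue. (f p - P p) * Q p) = 0)"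
  define D where "D = (\<lambda>p. P p - node_proj m k f p)"
  have D: "D \<in> orth_poly2 k" unfolding D_def using P by (intro orth_poly2_diff node_proj_orth) auto
  have "disc_inner D D = disc_inner P D - disc_inner (node_proj m k f) D"
    unfolding D_def
    by (intro disc_inner_diff_left cont[OF D, unfolded D_def] disc_integrable_poly2[OF node_proj_poly2]
        disc_integrable_poly2[of P k]) (use P in \<open>simp add: orth_poly2_iff\<close>)
  also have "\<dots> = 0" using P D di[of P D] disc_inner_node_proj_self[OF f k D] by auto
  finally have "D = (\<lambda>_. 0)" using D poly2_definite by (auto simp: orth_poly2_iff)
  then show "P = node_proj m k f" by (auto simp: D_def fun_eq_iff)
qed

theorem corollary3p3:
  fixes m :: nat and f :: "real \<times> real \<Rightarrow> real"
  assumes "f \<in> L2_disc"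
  shows "(\<forall>\<nu>\<le>2 * m. AE t in lebesgue. t \<in> {-1..1} \<longrightarrow> radon_exists (node m \<nu>) f t) \<and>
    (\<forall>x y. (\<forall>\<nu>\<le>2 * m. set_integrable lebesgue {-1..1}
                (\<lambda>t. radon (node m \<nu>) f t * Phi m \<nu> t (x, y))) \<and>
       partial_sum (2 * m) f (x, y) =
         (\<Sum>\<nu>\<le>2 * m. 1 / pi *
            (LINT t:{-1..1}|lebesgue. radon (node m \<nu>) f t * Phi m \<nu> t (x, y))))"
proof -
  have f: "disc_integrable f" using assms by (rule L2_disc_set_integrable)
  have cPhi: "continuous_on UNIV (\<lambda>t. Phi m \<nu> t p)" for \<nu> p
    unfolding Phi_def by (intro continuous_intros)
  \<comment> \<open>The Fubini identity is applied with \<open>h t = Phi m \<nu> t p\<close> for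
    fixed \<open>p\<close>. Replacing \<open>t\<close> by the ridge form turns each
    \<open>U k t\<close> into \<open>ridge_U k (node m \<nu>)\<close>, giving the terms of
    \<open>node_proj\<close> summed over \<open>k\<close> for one node.\<close>
  have int: "1 / pi * (LINT t:{-1..1}|lebesgue. radon (node m \<nu>) f t * Phi m \<nu> t p)
      = (\<Sum>k\<le>2 * m. node_weight m k *
          disc_inner f (ridge_U k (node m \<nu>)) * ridge_U k (node m \<nu>) p)" for \<nu> p
  proof -
    have "(LINT t:{-1..1}|lebesgue. radon (node m \<nu>) f t * Phi m \<nu> t p)
        = disc_inner f (\<lambda>q. Phi m \<nu> (ridge (node m \<nu>) q) p)"
      by (rule radon_integral(2)[OF f cPhi])
    also have "(\<lambda>q. Phi m \<nu> (ridge (node m \<nu>) q) p)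
        = (\<lambda>q. \<Sum>k\<le>2 * m. (real (k + 1) / real (2 * m + 1) * ridge_U k (node m \<nu>) p) * ridge_U k (node m \<nu>) q)"
      by (simp add: Phi_def sum_distrib_left ridge_U_eq mult_ac)
    also have "disc_inner f \<dots> = (\<Sum>k\<le>2 * m. (real (k + 1) / real (2 * m + 1) * ridge_U k (node m \<nu>) p) *
        disc_inner f (ridge_U k (node m \<nu>)))"
      unfolding disc_inner_scale_right[symmetric] by (intro disc_inner_sum_right f continuous_intros)
    finally show ?thesis by (simp add: sum_distrib_left node_weight_def mult_ac)
  qed
  have "partial_sum (2 * m) f p
      = (\<Sum>\<nu>\<le>2 * m. 1 / pi * (LINT t:{-1..1}|lebesgue. radon (node m \<nu>) f t * Phi m \<nu> t p))" for p
  proof -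
    have "partial_sum (2 * m) f p = (\<Sum>k\<le>2 * m. node_proj m k f p)"
      unfolding partial_sum_def by (simp add: proj_eq_node_proj[OF f])
    then show ?thesis unfolding int node_proj_def by (subst sum.swap)
  qed
  then show ?thesis
    using AE_radon_exists[OF f] radon_integral(1)[OF f cPhi] by simp
qed

end
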